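(* Let $\mathbb{K}$ be a field of characteristic zero and let $\gamma(x)=\sum_{n\ge 0}\gamma_n x^n\in\mathbb{K}[[x]]$. Then $\gamma$ is invariant under barycentric subdivisions in the class of simplices of all dimensions, that is, $\chi(\gamma,sd(\Delta_n))=\chi(\gamma,\Delta_n)$ for every $n\ge 0$, if and only if there is $c\in\mathbb{K}$ such that $\gamma(x)=\frac{c}{1+x}$, i.e. $\gamma_n=(-1)^n c$ for all $n\ge0$. In particular, $\gamma$ is a topological invariant for the class of finite simplicial complexes if and only if $\gamma(x)=\frac{c}{1+x}$ for some $c\in\mathbb{K}$.
   Context: For a finite simplicial complex $\mathcal{F}$ of dimension $m$, let $f_i^{\mathcal{F}}$ denote the number of $i$-dimensional faces of $\mathcal{F}$, $0\le i\le m$ (the empty face is not counted). Let $|\mathcal{F}|$ denote the geometric realization of $\mathcal{F}$, and let $sd(\mathcal{F})$ denote the barycentric subdivision of $\mathcal{F}$ (the simplicial complex whose vertices are the nonempty faces of $\mathcal{F}$ and whose simplices are the nonempty chains of such faces under strict inclusion). Let $\Delta_n$ denote the $n$-simplex viewed as an abstract simplicial complex, i.e. all nonempty subsets of a set of $n+1$ vertices. For a power series $\gamma(x)=\sum_{n\ge0}\gamma_n x^n\in\mathbb{K}[[x]]$ and a finite simplicial complex $\mathcal{F}$ of dimension $m$, define $\chi(\gamma,\mathcal{F})=\sum_{k=0}^{m}\gamma_k f_k^{\mathcal{F}}\in\mathbb{K}$. (In particular $\chi\left(\frac{1}{1+x},\mathcal{F}\right)$ is the Euler characteristic of $\mathcal{F}$.)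 The series $\gamma$ is called a topological invariant for the class of finite simplicial complexes if for any finite simplicial complexes $\mathcal{F}_1,\mathcal{F}_2$ such that $|\mathcal{F}_1|$ and $|\mathcal{F}_2|$ are homeomorphic, one has $\chi(\gamma,\mathcal{F}_1)=\chi(\gamma,\mathcal{F}_2)$. *)

theory Defs
  imports "HOL-Analysis.Analysis" "HOL-Library.Infinite_Typeclass"
begin

text \<open>
  A finite abstract simplicial complex is given by its set of faces.  The empty face is never
  listed; the complex without faces is admitted.
\<close>

definition finite_simplicial_complex :: "'a set set \<Rightarrow> bool" where
  "finite_simplicial_complex F \<longleftrightarrow>
     finite F \<and> (\<forall>\<sigma>\<in>F. finite \<sigma> \<and> \<sigma> \<noteq> {} \<and> (\<forall>\<tau>. \<tau> \<subseteq> \<sigma> \<and> \<tau> \<noteq> {} \<longrightarrow> \<tau> \<in> F))"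

definition num_faces :: "nat \<Rightarrow> 'a set set \<Rightarrow> nat" where
  "num_faces i F = card {\<sigma> \<in> F. card \<sigma> = i + 1}"

text \<open>
  The supremum over the empty set of natural numbers is \<open>0\<close>, so the complex without faces gets
  dimension \<open>0\<close> instead of \<open>-1\<close>.  This does not affect \<open>\<chi>\<close> below, since that complex has no
  faces to count.
\<close>

definition complex_dim :: "'a set set \<Rightarrow> nat" where
  "complex_dim F = (SUP \<sigma>\<in>F. card \<sigma> - 1)"

definition chi :: "'k::field fps \<Rightarrow> 'a set set \<Rightarrow> 'k" where
  "chi \<gamma> F = (\<Sum>k\<le>complex_dim F. fps_nth \<gamma> k * of_nat (num_faces k F))"

definition simplex_complex :: "nat \<Rightarrow> nat set set" where
  "simplex_complex n = {\<sigma>. \<sigma> \<subseteq> {..n} \<and> \<sigma> \<noteq> {}}"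

text \<open>\<^const>\<open>subset.chain\<close> is the library's notion of a chain with respect to strict inclusion.\<close>

definition barycentric_subdivision :: "'a set set \<Rightarrow> 'a set set set" where
  "barycentric_subdivision F = {C. C \<noteq> {} \<and> subset.chain F C}"

text \<open>
  Points of the geometric realization in barycentric coordinates: the support has to be a face.
  For a finite complex only finitely many coordinates are not identically \<open>0\<close>, so the product
  topology induces the usual Euclidean topology.
\<close>

definition geometric_realization :: "'a set set \<Rightarrow> ('a \<Rightarrow> real) topology" where
  "geometric_realization F =
     subtopology (powertop_real UNIV)
       {x. (\<forall>v. 0 \<le> x v) \<and> {v. x v \<noteq> 0} \<in> F \<and> (\<Sum>v | x v \<noteq> 0. x v) = 1}"

definition sd_invariant_on_simplices :: "'k::field fps \<Rightarrow> bool" where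
  "sd_invariant_on_simplices \<gamma> \<longleftrightarrow>
     (\<forall>n. chi \<gamma> (barycentric_subdivision (simplex_complex n)) = chi \<gamma> (simplex_complex n))"

text \<open>
  A quantifier inside a formula cannot range over types, so the vertices of the two complexes are
  taken from two given types.  An infinite type contains an isomorphic copy of every finite
  complex; hence for infinite types (which may differ, and may be sets of faces as for a
  subdivision) this is invariance on the whole class of finite complexes.
\<close>

definition topological_invariant :: "'a itself \<Rightarrow> 'b itself \<Rightarrow> 'k::field fps \<Rightarrow> bool" where
  "topological_invariant _ _ \<gamma> \<longleftrightarrow>
     (\<forall>(F\<^sub>1 :: 'a set set) (F\<^sub>2 :: 'b set set).
        finite_simplicial_complex F\<^sub>1 \<longrightarrow> finite_simplicial_complex F\<^sub>2 \<longrightarrow>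
        geometric_realization F\<^sub>1 homeomorphic_space geometric_realization F\<^sub>2 \<longrightarrow>
        chi \<gamma> F\<^sub>1 = chi \<gamma> F\<^sub>2)"

instance set :: (infinite) infinite
  by intro_classes (simp add: Finite_Set.finite_set infinite_UNIV)

lemma finite_simplicial_complex_simplex_complex: "finite_simplicial_complex (simplex_complex n)"
  unfolding finite_simplicial_complex_def simplex_complex_def
  by (auto intro: finite_subset)

lemma finite_simplicial_complex_barycentric_subdivision:
  assumes "finite_simplicial_complex F"
  shows "finite_simplicial_complex (barycentric_subdivision F)"
proof -
  have fin: "finite F"
    using assms by (simp add: finite_simplicial_complex_def)
  have "barycentric_subdivision F \<subseteq> Pow F"
    by (auto simp: barycentric_subdivision_def subset_chain_def)
  then have "finite (barycentric_subdivision F)"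
    using fin by (meson finite_Pow_iff finite_subset)
  moreover have "finite C" if "C \<in> barycentric_subdivision F" for C
    using that fin finite_subset by (auto simp: barycentric_subdivision_def subset_chain_def)
  moreover have "D \<in> barycentric_subdivision F"
    if "C \<in> barycentric_subdivision F" "D \<subseteq> C" "D \<noteq> {}" for C D
    using that unfolding barycentric_subdivision_def subset_chain_def mem_Collect_eq
    by (meson subset_eq)
  moreover have "{} \<notin> barycentric_subdivision F"
    by (simp add: barycentric_subdivision_def)
  ultimately show ?thesis
    unfolding finite_simplicial_complex_def by metis
qed

end

(*
  Topological invariance of the Euler characteristic is derived from the homology library.  The
  torsion-free rank is additive along exact sequences, so the Euler characteristic of singular
  homology is additive for a cover by two open sets.  For a vertex v of a complex F, the sets
  {x. x v < 1} and {x. 0 < x v} cover |F|; the first retracts onto the deletion of v, the second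
  is contractible, and their intersection is homotopy equivalent to the link of v.  Induction on
  the number of faces identifies the homological with the combinatorial Euler characteristic.

  Conversely, if all coefficients below n vanish, invariance under subdivision of the n-simplex
  reads N * \<gamma>_n = \<gamma>_n, where N > 1 is the number of maximal chains of faces; subtracting a
  multiple of the Euler characteristic reduces to this case.  For topological invariance a single
  subdivided edge suffices: on a simplex with n + 2 vertices it changes \<chi> by the sum of
  \<gamma>_|\<sigma>| + \<gamma>_(|\<sigma>|+1) over the sets \<sigma> of vertices outside the edge.  This avoids a
  homeomorphism for the barycentric subdivision.
*)

theory Submission
  imports Defs "HOL-Homology.Homology"
begin

section \<open>Torsion-free rank of abelian groups\<close>

text \<open>The homology of |F| is never computed. The alternating sum of Betti numbers obeys a
  recursion in which the connecting maps cancel, and the alternating face count obeys the same one,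
  e(F) = e(deletion) + 1 - e(link). The link enters with a minus sign on both sides: coning a face
  with \<open>v\<close> raises its dimension by one, and the intersection of the cover is counted
  twice.

  Rank, Betti number and Euler characteristic are relations here, so each use has to supply
  existence together with the value. Exactness supplies both: the middle term of an exact triple has
  finite rank, bounded by those of its neighbours, so finiteness and eventual vanishing survive
  every gluing.

  Both converses solve a triangular system, as a larger simplex isolates one new unknown. For the
  barycentric subdivision the unknown is a coefficient and the pivot N - 1 is nonzero in
  characteristic zero. For the edge the unknown is a sum of two consecutive coefficients and the
  pivot is 1, since only one set of outside vertices has full size.\<close>

lemma integer_relation:
  fixes a :: "'i \<Rightarrow> 'j \<Rightarrow> int"
  assumes "finite I" "finite J" "card I < card J"
  obtains c where "\<exists>j\<in>J. c j \<noteq> 0" "\<And>i. i \<in> I \<Longrightarrow> (\<Sum>j\<in>J. c j * a i j) = 0"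
proof -
  have "\<exists>c. (\<exists>j\<in>J. c j \<noteq> 0) \<and> (\<forall>i\<in>I. (\<Sum>j\<in>J. c j * a i j) = 0)"
    using assms
  proof (induction I arbitrary: J a rule: finite_induct)
    case empty
    then show ?case by (intro exI[of _ "\<lambda>_. 1"]) (auto simp: card_gt_0_iff)
  next
    case (insert i I)
    show ?case
    proof (cases "\<forall>j\<in>J. a i j = 0")
      case True
      have "card I < card J" using insert by simp
      with insert.IH[OF insert.prems(1)] obtain c where
        "\<exists>j\<in>J. c j \<noteq> 0" "\<forall>i\<in>I. (\<Sum>j\<in>J. c j * a i j) = 0" by metis
      with True show ?thesis by (intro exI[of _ c]) auto
    next
      case False
      then obtain k where k: "k \<in> J" "a i k \<noteq> 0" by auto
      define J' where "J' = J - {k}"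
      have J': "finite J'" "k \<notin> J'" "J = insert k J'" using k insert.prems by (auto simp: J'_def)
      have "card I < card J'" using insert.prems insert.hyps J' by simp
      \<comment> \<open>Fraction-free elimination with pivot \<open>a i k\<close>: the smaller
        system consists of 2x2 minors. Below, \<open>d\<close> scales its solution by the pivot, so
        that row \<open>i\<close> can be solved for the entry at \<open>k\<close> within the
        integers.\<close>
      with insert.IH[OF J'(1), of "\<lambda>i' j. a i k * a i' j - a i' k * a i j"] obtain c where
        c: "\<exists>j\<in>J'. c j \<noteq> 0"
           "\<forall>i'\<in>I. (\<Sum>j\<in>J'. c j * (a i k * a i' j - a i' k * a i j)) = 0" by metis
      define d where "d j = (if j = k then - (\<Sum>j\<in>J'. c j * a i j) else a i k * c j)" for j
      have d: "(\<Sum>j\<in>J. d j * a i' j) =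
          (\<Sum>j\<in>J'. c j * (a i k * a i' j - a i' k * a i j))" for i'
      proof -
        have "(\<Sum>j\<in>J. d j * a i' j) = d k * a i' k + (\<Sum>j\<in>J'. d j * a i' j)"
          using J' by simp
        also have "(\<Sum>j\<in>J'. d j * a i' j) = (\<Sum>j\<in>J'. a i k * c j * a i' j)"
          using J' by (intro sum.cong) (auto simp: d_def)
        finally show ?thesis
          by (simp add: d_def sum_distrib_left sum_distrib_right sum_subtractf algebra_simps)
      qed
      have "\<exists>j\<in>J. d j \<noteq> 0" using c(1) J' k by (auto simp: d_def)
      moreover have "\<forall>i'\<in>insert i I. (\<Sum>j\<in>J. d j * a i' j) = 0"
        using c(2) by (auto simp: d algebra_simps)
      ultimately show ?thesis by blast
    qed
  qed
  with that show thesis by blast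
qed

definition zcomb :: "('g, 'm) monoid_scheme \<Rightarrow> 'g set \<Rightarrow> ('g \<Rightarrow> int) \<Rightarrow> 'g" where
  "zcomb G S c = finprod G (\<lambda>s. s [^]\<^bsub>G\<^esub> c s) S"

definition zindep :: "('g, 'm) monoid_scheme \<Rightarrow> 'g set \<Rightarrow> bool" where
  "zindep G S \<longleftrightarrow> finite S \<and> S \<subseteq> carrier G \<and>
     (\<forall>c. zcomb G S c = \<one>\<^bsub>G\<^esub> \<longrightarrow> (\<forall>s\<in>S. c s = 0))"

text \<open>Asking only for a nonzero multiple makes torsion invisible; this is spanning after
  tensoring with the rationals.\<close>

definition zspans :: "('g, 'm) monoid_scheme \<Rightarrow> 'g set \<Rightarrow> 'g set \<Rightarrow> bool" where
  "zspans G S A \<longleftrightarrow> finite S \<and> S \<subseteq> carrier G \<and>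
     (\<forall>x\<in>A. \<exists>N c. N \<noteq> 0 \<and> x [^]\<^bsub>G\<^esub> (N::int) = zcomb G S c)"

text \<open>The torsion-free rank; it is defined for subsets so that kernels and images need not be
  turned into groups.\<close>

definition zrank :: "('g, 'm) monoid_scheme \<Rightarrow> 'g set \<Rightarrow> nat \<Rightarrow> bool" where
  "zrank G A n \<longleftrightarrow> (\<exists>S\<subseteq>A. zindep G S \<and> zspans G S A \<and> card S = n)"

context comm_group
begin

lemma zcomb_closed [simp, intro]: "S \<subseteq> carrier G \<Longrightarrow> zcomb G S c \<in> carrier G"
  unfolding zcomb_def by (intro finprod_closed) auto

lemma zcomb_cong: "S \<subseteq> carrier G \<Longrightarrow> (\<And>s. s \<in> S \<Longrightarrow> c s = d s) \<Longrightarrow> zcomb G S c = zcomb G S d"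
  unfolding zcomb_def by (intro finprod_cong') auto

lemma zcomb_insert:
  "finite S \<Longrightarrow> insert x S \<subseteq> carrier G \<Longrightarrow> x \<notin> S \<Longrightarrow>
     zcomb G (insert x S) c = x [^] c x \<otimes> zcomb G S c"
  unfolding zcomb_def by (subst finprod_insert) auto

lemma zcomb_zero: "S \<subseteq> carrier G \<Longrightarrow> (\<And>s. s \<in> S \<Longrightarrow> c s = 0) \<Longrightarrow> zcomb G S c = \<one>"
  unfolding zcomb_def by (intro finprod_one_eqI) auto

lemma zcomb_add:
  "S \<subseteq> carrier G \<Longrightarrow> zcomb G S (\<lambda>s. c s + d s) = zcomb G S c \<otimes> zcomb G S d"
  unfolding zcomb_def
  by (subst finprod_multf[symmetric]) (auto intro!: finprod_cong' simp: int_pow_mult Pi_iff)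

lemma zcomb_pow:
  assumes "finite S" "S \<subseteq> carrier G"
  shows "zcomb G S c [^] (k::int) = zcomb G S (\<lambda>s. c s * k)"
  using assms
proof (induction S rule: finite_induct)
  case empty
  then show ?case by (simp add: zcomb_def)
next
  case (insert x S)
  then show ?case
    by (simp add: zcomb_insert int_pow_distrib zcomb_closed int_pow_pow)
qed

lemma zcomb_Un:
  assumes "finite S" "finite T" "S \<inter> T = {}" "S \<subseteq> carrier G" "T \<subseteq> carrier G"
  shows "zcomb G (S \<union> T) c = zcomb G S c \<otimes> zcomb G T c"
  unfolding zcomb_def using assms by (intro finprod_Un_disjoint) auto

text \<open>Steinitz bound. Multiples \<open>N s\<close> of the elements of \<open>S\<close> are
  combinations of \<open>T\<close>; if \<open>S\<close> were larger, the columns of exponents would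
  satisfy an integer relation \<open>c\<close>, and \<open>N s * c s\<close> would be a nontrivial
  relation in \<open>S\<close>.\<close>

lemma zindep_card_le:
  assumes S: "zindep G S" "S \<subseteq> A" and T: "zspans G T A"
  shows "card S \<le> card T"
proof (rule ccontr)
  assume "\<not> card S \<le> card T"
  have fin: "finite S" "finite T" "S \<subseteq> carrier G" "T \<subseteq> carrier G"
    using S T by (auto simp: zindep_def zspans_def)
  have "\<forall>s\<in>S. \<exists>N c. N \<noteq> 0 \<and> s [^] (N::int) = zcomb G T c"
    using S T by (auto simp: zspans_def)
  then obtain N a where Na: "\<And>s. s \<in> S \<Longrightarrow> N s \<noteq> 0 \<and> s [^] (N s :: int) = zcomb G T (a s)"
    by metis
  obtain c where c: "\<exists>s\<in>S. c s \<noteq> 0" "\<And>t. t \<in> T \<Longrightarrow> (\<Sum>s\<in>S. c s * a s t) = 0"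
    using integer_relation[of T S "\<lambda>t s. a s t"] fin \<open>\<not> card S \<le> card T\<close> by (metis not_le)
  have sum: "finprod G (\<lambda>s. zcomb G T (\<lambda>t. a s t * c s)) R = zcomb G T (\<lambda>t. \<Sum>s\<in>R. a s t * c s)"
    if "finite R" for R
    using that fin
    by (induction R rule: finite_induct) (simp_all add: zcomb_zero zcomb_add zcomb_closed)
  have "zcomb G S (\<lambda>s. N s * c s) = finprod G (\<lambda>s. zcomb G T (\<lambda>t. a s t * c s)) S"
    unfolding zcomb_def[of G S]
  proof (intro finprod_cong' refl)
    fix s assume s: "s \<in> S"
    then have "s \<in> carrier G" using fin by auto
    then have "s [^] (N s * c s) = (s [^] N s) [^] c s" by (simp add: int_pow_pow)
    also have "\<dots> = zcomb G T (\<lambda>t. a s t * c s)" using Na[OF s] fin by (simp add: zcomb_pow)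
    finally show "s [^] (N s * c s) = zcomb G T (\<lambda>t. a s t * c s)" .
  qed (use fin in auto)
  also have "\<dots> = zcomb G T (\<lambda>t. \<Sum>s\<in>S. a s t * c s)" using sum fin by blast
  also have "\<dots> = \<one>" using c(2) fin by (intro zcomb_zero) (auto simp: mult.commute)
  finally have "\<forall>s\<in>S. N s * c s = 0" using S(1) unfolding zindep_def by blast
  with c(1) Na show False by auto
qed

lemma zrank_unique: "zrank G A m \<Longrightarrow> zrank G A n \<Longrightarrow> m = n"
  unfolding zrank_def using zindep_card_le by (metis le_antisym)

lemma zrank_trivial: "zrank G {\<one>} 0"
proof -
  have "zspans G {} {\<one>}"
    by (auto simp: zspans_def zcomb_def intro: exI[of _ "1::int"])
  then show ?thesis
    unfolding zrank_def by (intro exI[of _ "{}"]) (auto simp: zindep_def)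
qed

text \<open>An independent subset of largest size spans up to multiples: adjoining \<open>x\<close>
  creates a relation, and its coefficient at \<open>x\<close> cannot vanish. The bound is what
  guarantees a largest size.\<close>

lemma zrank_exists:
  assumes A: "A \<subseteq> carrier G" and bound: "\<And>S. S \<subseteq> A \<Longrightarrow> zindep G S \<Longrightarrow> card S \<le> n"
  obtains m where "zrank G A m"
proof -
  have ex: "\<exists>S\<subseteq>A. zindep G S \<and> card S = 0"
    by (intro exI[of _ "{}"]) (auto simp: zindep_def)
  define m where "m = (GREATEST k. \<exists>S\<subseteq>A. zindep G S \<and> card S = k)"
  have "\<exists>S\<subseteq>A. zindep G S \<and> card S = m"
    unfolding m_def by (rule GreatestI_nat[where P = "\<lambda>k. \<exists>S\<subseteq>A. zindep G S \<and> card S = k", OF ex])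
      (use bound in blast)
  then obtain S where S: "S \<subseteq> A" "zindep G S" "card S = m" by blast
  have max: "card S' \<le> m" if "S' \<subseteq> A" "zindep G S'" for S'
    unfolding m_def
    by (rule Greatest_le_nat[where P = "\<lambda>k. \<exists>S\<subseteq>A. zindep G S \<and> card S = k" and b = n])
      (use bound that in blast)+
  have fin: "finite S" "S \<subseteq> carrier G" using S by (auto simp: zindep_def)
  have "\<exists>N c. N \<noteq> 0 \<and> x [^] (N::int) = zcomb G S c" if x: "x \<in> A" for x
  proof (cases "x \<in> S")
    case True
    have "zcomb G S (\<lambda>s. if s = x then 1 else 0) = x [^] (1::int)"
    proof -
      have "zcomb G (S - {x}) (\<lambda>s. if s = x then 1 else 0) = \<one>"
        using fin by (intro zcomb_zero) auto
      moreover have "insert x (S - {x}) = S" using True by auto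
      ultimately show ?thesis
        using zcomb_insert[of "S - {x}" x "\<lambda>s. if s = x then 1 else 0"] fin x A True by auto
    qed
    then show ?thesis by (metis zero_neq_one)
  next
    case False
    then have "\<not> zindep G (insert x S)" using max[of "insert x S"] S x fin by auto
    then obtain c where c: "zcomb G (insert x S) c = \<one>" "\<exists>s\<in>insert x S. c s \<noteq> 0"
      using fin x A by (auto simp: zindep_def)
    have eq: "x [^] c x \<otimes> zcomb G S c = \<one>"
      using c(1) zcomb_insert fin x A False by (metis insert_subset subsetD)
    have "c x \<noteq> 0"
    proof
      assume "c x = 0"
      then have "zcomb G S c = \<one>" using eq fin by (simp add: zcomb_closed)
      then show False using S c(2) \<open>c x = 0\<close> by (auto simp: zindep_def)
    qed
    moreover have "x [^] c x = zcomb G S (\<lambda>s. c s * (-1))"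
    proof -
      have "zcomb G S c [^] (-1::int) = inv (zcomb G S c)"
        using fin zcomb_closed by (metis int_pow_1 int_pow_neg)
      moreover have "x [^] c x = inv (zcomb G S c)"
        using eq fin x A by (metis inv_equality int_pow_closed subsetD zcomb_closed)
      ultimately show ?thesis using zcomb_pow fin by metis
    qed
    ultimately show ?thesis by blast
  qed
  then have "zspans G S A" using fin by (simp add: zspans_def)
  then have "zrank G A m" unfolding zrank_def using S by (intro exI[of _ S]) simp
  then show thesis by (rule that)
qed

lemma zrank_subset:
  assumes "zrank G A n" "B \<subseteq> A" "A \<subseteq> carrier G"
  obtains m where "m \<le> n" "zrank G B m"
proof -
  obtain T where T: "zspans G T A" "card T = n" using assms by (auto simp: zrank_def)
  have b: "card S \<le> n" if "S \<subseteq> B" "zindep G S" for S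
    using zindep_card_le[OF that(2) _ T(1)] that assms T by auto
  obtain m where m: "zrank G B m"
    by (rule zrank_exists[of B n]) (use assms b in auto)
  moreover have "m \<le> n" using m b by (auto simp: zrank_def)
  ultimately show thesis using that by blast
qed

end

lemma zrank_integer_group: "zrank integer_group (carrier integer_group) 1"
proof -
  interpret comm_group integer_group by (rule abelian_integer_group)
  have c: "zcomb integer_group {1} c = c 1" for c
    by (simp add: zcomb_def)
  have "\<exists>N c. N \<noteq> 0 \<and> x [^]\<^bsub>integer_group\<^esub> (N::int) = zcomb integer_group {1} c" for x
    by (rule exI[of _ 1], rule exI[of _ "\<lambda>_. x"]) (simp add: c)
  then have "zspans integer_group {1} (carrier integer_group)" by (simp add: zspans_def)
  moreover have "zindep integer_group {1}" by (simp add: zindep_def c)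
  ultimately show ?thesis unfolding zrank_def by (intro exI[of _ "{1}"]) simp
qed

section \<open>Ranks of kernels and images\<close>

locale comm_group_hom = G: comm_group G + H: comm_group H
  for G (structure) and H (structure) + 
  fixes h assumes hom: "h \<in> hom G H"
begin

sublocale group_hom G H h
  by unfold_locales (rule hom)

lemma hom_zcomb:
  assumes "finite S" "S \<subseteq> carrier G" "inj_on h S"
  shows "h (zcomb G S c) = zcomb H (h ` S) (\<lambda>t. c (inv_into S h t))"
  using assms
proof (induction S rule: finite_induct)
  case empty
  then show ?case by (simp add: zcomb_def)
next
  case (insert x S)
  have "zcomb H (h ` insert x S) (\<lambda>t. c (inv_into (insert x S) h t)) =
     h x [^]\<^bsub>H\<^esub> c x \<otimes>\<^bsub>H\<^esub> zcomb H (h ` S) (\<lambda>t. c (inv_into (insert x S) h t))"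
  proof -
    have "h x \<notin> h ` S" using insert by auto
    moreover have "inv_into (insert x S) h (h x) = x"
      using insert.prems by (intro inv_into_f_f) auto
    moreover have "insert (h x) (h ` S) \<subseteq> carrier H" using insert by auto
    ultimately show ?thesis
      using H.zcomb_insert[of "h ` S" "h x"] insert.hyps by simp
  qed
  also have "zcomb H (h ` S) (\<lambda>t. c (inv_into (insert x S) h t)) =
     zcomb H (h ` S) (\<lambda>t. c (inv_into S h t))"
    using insert by (intro H.zcomb_cong) (auto simp: inj_on_insert)
  finally show ?case using insert by (simp add: G.zcomb_insert hom_int_pow G.zcomb_closed)
qed

lemma zindep_lift:
  assumes S: "finite S" "S \<subseteq> carrier G" "inj_on h S" and U: "zindep H (h ` S)"
  shows "zindep G S"
  unfolding zindep_def
proof (intro conjI allI impI ballI)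
  fix c s assume "zcomb G S c = \<one>" "s \<in> S"
  then have "zcomb H (h ` S) (\<lambda>t. c (inv_into S h t)) = \<one>\<^bsub>H\<^esub>"
    using hom_zcomb[OF S, of c] by simp
  then have "\<forall>t\<in>h ` S. c (inv_into S h t) = 0" using U by (auto simp: zindep_def)
  then show "c s = 0" using \<open>s \<in> S\<close> S by auto
qed (use S in auto)

text \<open>Preimages of independent elements are independent, so every independent subset of the
  image has at most \<open>n\<close> elements.\<close>

lemma zrank_image:
  assumes "zrank G (carrier G) n"
  obtains m where "m \<le> n" "zrank H (h ` carrier G) m"
proof -
  obtain T where T: "zspans G T (carrier G)" "card T = n" using assms by (auto simp: zrank_def)
  have b: "card U \<le> n" if U: "U \<subseteq> h ` carrier G" "zindep H U" for U
  proof -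
    obtain S where S: "S \<subseteq> carrier G" "inj_on h S" "U = h ` S"
      using U(1) by (meson subset_image_inj)
    have "finite S" using S U by (auto simp: zindep_def finite_image_iff)
    then have "zindep G S" using zindep_lift S U by blast
    then show ?thesis using G.zindep_card_le T S by (metis card_image)
  qed
  obtain m where m: "zrank H (h ` carrier G) m"
    by (rule H.zrank_exists[of "h ` carrier G" n]) (use b in auto)
  moreover have "m \<le> n" using m b by (auto simp: zrank_def)
  ultimately show thesis using that by blast
qed

text \<open>Rank-nullity: a basis \<open>T\<close> of the kernel and preimages \<open>S\<close> of a
  basis of the image together form a basis of the whole group.\<close>

lemma zrank_kernel_image:
  assumes "zrank G (kernel G H h) k" "zrank H (h ` carrier G) m"
  shows "zrank G (carrier G) (k + m)"
proof -
  obtain T where T: "T \<subseteq> kernel G H h" "zindep G T" "zspans G T (kernel G H h)" "card T = k"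
    using assms by (auto simp: zrank_def)
  obtain U where U: "U \<subseteq> h ` carrier G" "zindep H U" "zspans H U (h ` carrier G)" "card U = m"
    using assms by (auto simp: zrank_def)
  obtain S where S: "S \<subseteq> carrier G" "inj_on h S" "U = h ` S"
    using U(1) by (meson subset_image_inj)
  have fin: "finite S" "finite T" "T \<subseteq> carrier G"
    using S U T by (auto simp: zindep_def finite_image_iff)
  have Sind: "zindep G S" using zindep_lift S U fin by blast
  have hT: "h t = \<one>\<^bsub>H\<^esub>" if "t \<in> T" for t using T that by (auto simp: kernel_def)
  \<comment> \<open>An independent set omits the unit. As \<open>h\<close> sends \<open>T\<close> to
    the unit and \<open>S\<close> into \<open>U\<close>, the two sets are disjoint and their sizes
    add up.\<close>
  have "\<one>\<^bsub>H\<^esub> \<notin> U"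
  proof
    assume one: "\<one>\<^bsub>H\<^esub> \<in> U"
    have "zcomb H U (\<lambda>u. if u = \<one>\<^bsub>H\<^esub> then 1 else 0) = \<one>\<^bsub>H\<^esub>"
      unfolding zcomb_def using U by (intro H.finprod_one_eqI) (auto simp: zindep_def)
    then have "\<forall>u\<in>U. (if u = \<one>\<^bsub>H\<^esub> then 1 else 0) = (0::int)"
      using U(2) unfolding zindep_def by blast
    with one show False by auto
  qed
  then have disj: "T \<inter> S = {}" using hT S by force
  have hzT: "h (zcomb G T c) = \<one>\<^bsub>H\<^esub>" for c
  proof -
    have "zcomb G T c \<in> kernel G H h"
      using fin(2) fin(3) T(1)
    proof (induction T rule: finite_induct)
      case empty
      then show ?case by (simp add: zcomb_def kernel_def)
    next
      case (insert x T)
      then show ?case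
        by (simp add: G.zcomb_insert kernel_def hom_int_pow G.zcomb_closed)
    qed
    then show ?thesis by (simp add: kernel_def)
  qed
  have "zindep G (T \<union> S)"
    unfolding zindep_def
  proof (intro conjI allI impI)
    fix c assume c: "zcomb G (T \<union> S) c = \<one>"
    then have e: "zcomb G T c \<otimes> zcomb G S c = \<one>" using fin S disj by (simp add: G.zcomb_Un)
    then have "h (zcomb G T c \<otimes> zcomb G S c) = \<one>\<^bsub>H\<^esub>" by simp
    then have "h (zcomb G S c) = \<one>\<^bsub>H\<^esub>" using fin S by (simp add: hzT G.zcomb_closed)
    then have "zcomb H (h ` S) (\<lambda>t. c (inv_into S h t)) = \<one>\<^bsub>H\<^esub>"
      using hom_zcomb[OF fin(1) S(1,2), of c] by simp
    then have "\<forall>t\<in>h ` S. c (inv_into S h t) = 0" using U S by (auto simp: zindep_def)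
    then have cS: "\<forall>s\<in>S. c s = 0" using S by auto
    then have "zcomb G T c = \<one>" using e fin S by (simp add: G.zcomb_zero G.zcomb_closed)
    then have "\<forall>t\<in>T. c t = 0" using T by (auto simp: zindep_def)
    with cS show "\<forall>s\<in>T \<union> S. c s = 0" by auto
  qed (use fin S in auto)
  moreover have "zspans G (T \<union> S) (carrier G)"
    unfolding zspans_def
  proof (intro conjI ballI)
    fix x assume x: "x \<in> carrier G"
    then have "\<exists>N c. N \<noteq> 0 \<and> h x [^]\<^bsub>H\<^esub> (N::int) = zcomb H U c"
      using U(3) by (auto simp: zspans_def)
    then obtain N c where N: "N \<noteq> 0" "h x [^]\<^bsub>H\<^esub> (N::int) = zcomb H U c" by blast
    \<comment> \<open>\<open>y\<close> lifts the combination that equals the power \<open>N\<close>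
      of \<open>h x\<close>, so \<open>x [^] N\<close> and \<open>y\<close> differ by an element of
      the kernel; a further power \<open>M\<close> brings this element into the span of
      \<open>T\<close>.\<close>
    define y where "y = zcomb G S (\<lambda>s. c (h s))"
    have y: "y \<in> carrier G" unfolding y_def using S by auto
    have hy: "h y = zcomb H U c"
      unfolding y_def hom_zcomb[OF fin(1) S(1,2)] S(3)
      using S by (intro H.zcomb_cong) auto
    have "x [^] N \<otimes> inv y \<in> kernel G H h"
      using x y N hy by (simp add: kernel_def hom_int_pow)
        (metis H.r_inv hom_closed)
    then have "\<exists>M d. M \<noteq> 0 \<and> (x [^] N \<otimes> inv y) [^] (M::int) = zcomb G T d"
      using T(3) by (auto simp: zspans_def)
    then obtain M d where M: "M \<noteq> 0" "(x [^] N \<otimes> inv y) [^] (M::int) = zcomb G T d" by blast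
    have "x [^] (N * M) = (x [^] N \<otimes> inv y \<otimes> y) [^] M"
      using x y by (simp add: G.m_assoc G.int_pow_pow)
    also have "\<dots> = zcomb G T d \<otimes> zcomb G S (\<lambda>s. c (h s) * M)"
      using x y M fin S by (simp add: G.int_pow_distrib y_def G.zcomb_pow)
    also have "\<dots> = zcomb G (T \<union> S) (\<lambda>s. if s \<in> T then d s else c (h s) * M)"
      using fin S disj
      by (subst G.zcomb_Un) (auto intro!: arg_cong2[where f = "(\<otimes>)"] G.zcomb_cong)
    finally show "\<exists>N c. N \<noteq> 0 \<and> x [^] (N::int) = zcomb G (T \<union> S) c"
      using N M by (intro exI[of _ "N * M"] exI conjI) auto
  qed (use fin S in auto)
  moreover have "card (T \<union> S) = k + m"
    using fin disj T U S by (simp add: card_Un_disjoint card_image)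
  moreover have "T \<union> S \<subseteq> carrier G" using fin S by blast
  ultimately show ?thesis unfolding zrank_def by (intro exI[of _ "T \<union> S"]) simp
qed

end

lemma zrank_iso:
  assumes "G \<cong> H" "comm_group G" "comm_group H" "zrank H (carrier H) n"
  shows "zrank G (carrier G) n"
proof -
  obtain h where h: "h \<in> iso G H" using assms by (auto simp: is_iso_def)
  interpret comm_group_hom G H h
    using assms h by (auto simp: comm_group_hom_def comm_group_hom_axioms_def iso_def)
  have "kernel G H h = {\<one>\<^bsub>G\<^esub>}"
    using h inj_on_one_iff by (auto simp: kernel_def iso_def bij_betw_def)
  then have "zrank G (kernel G H h) 0" using G.zrank_trivial by simp
  moreover have "h ` carrier G = carrier H" using h by (auto simp: iso_def bij_betw_def)
  ultimately show ?thesis using zrank_kernel_image[of 0 n] assms by simp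
qed

section \<open>Euler characteristic of singular homology\<close>

lemma comm_group_hom_exact:
  assumes "exact_seq ([C, B, A], [g, f])" "comm_group A" "comm_group B" "comm_group C"
  shows "comm_group_hom A B f" "comm_group_hom B C g" "kernel B C g = f ` carrier A"
  using assms by (auto simp: comm_group_hom_def comm_group_hom_axioms_def group_hom_def group_hom_axioms_def)

text \<open>The ranks \<open>k\<close> and \<open>m\<close> are attached to the two images
  themselves, because each image recurs in a neighbouring segment of the long exact sequence, where
  it has to get the same number.\<close>

lemma zrank_exact:
  assumes ex: "exact_seq ([C, B, A], [g, f])" and ab: "comm_group A" "comm_group B" "comm_group C"
    and A: "zrank A (carrier A) a" and C: "zrank C (carrier C) c"
  obtains k m where "zrank B (f ` carrier A) k" "zrank C (g ` carrier B) m"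
    "zrank B (carrier B) (k + m)" "k \<le> a" "m \<le> c"
proof -
  note * = comm_group_hom_exact[OF ex ab]
  interpret f: comm_group_hom A B f by (rule *)
  interpret g: comm_group_hom B C g by (rule *)
  obtain k where k: "k \<le> a" "zrank B (f ` carrier A) k" using f.zrank_image[OF A] .
  have "g ` carrier B \<subseteq> carrier C" by auto
  then obtain m where m: "m \<le> c" "zrank C (g ` carrier B) m"
    using g.H.zrank_subset[OF C] by blast
  show thesis using that[of k m] k m g.zrank_kernel_image[of k m] *(3) by simp
qed

definition betti :: "int \<Rightarrow> 'a topology \<Rightarrow> 'a set \<Rightarrow> nat \<Rightarrow> bool" where
  "betti p X S n \<longleftrightarrow>
     zrank (relative_homology_group p X S) (carrier (relative_homology_group p X S)) n"

lemma betti_unique: "betti p X S m \<Longrightarrow> betti p X S n \<Longrightarrow> m = n"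
  unfolding betti_def by (rule comm_group.zrank_unique[OF abelian_relative_homology_group])

lemma betti_iso:
  "relative_homology_group p X S \<cong> relative_homology_group p Y T \<Longrightarrow> betti p Y T n \<Longrightarrow> betti p X S n"
  unfolding betti_def by (erule zrank_iso) auto

lemma betti_trivial: "trivial_group (relative_homology_group p X S) \<Longrightarrow> betti p X S 0"
  unfolding betti_def trivial_group_def
  using comm_group.zrank_trivial[OF abelian_relative_homology_group[of p X S]] by simp

text \<open>A relation, because the Betti numbers may be infinite or nonzero in infinitely many
  degrees; a total function would have junk values there.\<close>

definition euler_char :: "'a topology \<Rightarrow> 'a set \<Rightarrow> int \<Rightarrow> bool" where
  "euler_char X S e \<longleftrightarrow> (\<exists>b. (\<forall>p. betti (int p) X S (b p)) \<and>
     (\<forall>\<^sub>F N in sequentially. b N = 0 \<and> (\<Sum>p<N. (-1) ^ p * int (b p)) = e))"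

lemma euler_char_unique:
  assumes "euler_char X S d" "euler_char X S e"
  shows "d = e"
proof -
  obtain b where b: "\<And>p. betti (int p) X S (b p)"
    "\<forall>\<^sub>F N in sequentially. b N = 0 \<and> (\<Sum>p<N. (-1) ^ p * int (b p)) = d"
    using assms(1) by (auto simp: euler_char_def)
  obtain b' where b': "\<And>p. betti (int p) X S (b' p)"
    "\<forall>\<^sub>F N in sequentially. b' N = 0 \<and> (\<Sum>p<N. (-1) ^ p * int (b' p)) = e"
    using assms(2) by (auto simp: euler_char_def)
  have "b = b'" using b b' betti_unique by blast
  with eventually_happens'[OF sequentially_bot eventually_conj[OF b(2) b'(2)]] show ?thesis
    by auto
qed

lemma euler_char_iso:
  assumes "\<And>p. relative_homology_group p X S \<cong> relative_homology_group p Y T" "euler_char Y T e"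
  shows "euler_char X S e"
  using assms(2) betti_iso[OF assms(1)] unfolding euler_char_def by blast

lemma euler_char_homotopy_equivalent:
  "X homotopy_equivalent_space Y \<Longrightarrow> euler_char Y {} e \<Longrightarrow> euler_char X {} e"
  by (erule euler_char_iso[rotated]) (rule homotopy_equivalent_space_imp_isomorphic_homology_groups)

lemma euler_char_empty:
  assumes "topspace X = {}"
  shows "euler_char X {} 0"
  unfolding euler_char_def
  using betti_trivial[OF trivial_homology_group_empty[OF assms]]
  by (intro exI[of _ "\<lambda>_. 0"]) simp

lemma euler_char_singleton:
  assumes "topspace X = {a}"
  shows "euler_char X {} 1"
  unfolding euler_char_def
proof (intro exI[of _ "\<lambda>p::nat. if p = 0 then 1 else 0"] conjI allI)
  fix p :: nat
  show "betti (int p) X {} (if p = 0 then 1 else 0)"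
  proof (cases "p = 0")
    case True
    have "betti 0 X {} 1"
      unfolding betti_def
      by (rule zrank_iso[OF homology_coefficients[OF assms]])
        (auto intro: abelian_integer_group zrank_integer_group[simplified])
    with True show ?thesis by simp
  next
    case False
    then show ?thesis using homology_dimension_axiom[OF assms, of "int p"]
      by (auto intro: betti_trivial)
  qed
next
  have "(\<Sum>p<N. (-1) ^ p * int (if p = 0 then 1 else 0)) = 1" if "N \<ge> 1" for N :: nat
  proof -
    have "(\<Sum>p<N. (-1) ^ p * int (if p = 0 then 1 else 0)) = (\<Sum>p<N. if p = 0 then 1 else 0)"
      by (intro sum.cong) auto
    then show ?thesis using that by simp
  qed
  then show "\<forall>\<^sub>F N in sequentially. (if N = 0 then 1 else 0) = (0::nat) \<and>
      (\<Sum>p<N. (-1) ^ p * int (if p = 0 then 1 else 0)) = 1"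
    by (intro eventually_sequentiallyI[of 1]) auto
qed

text \<open>\<open>d p\<close>, \<open>i p\<close> and \<open>j p\<close> are the ranks of the images of the maps in the long exact sequence
  of a pair, so that \<open>d (p + 1) + i p\<close>, \<open>i p + j p\<close> and \<open>j p + d p\<close> are the Betti numbers of the
  subspace, the space and the pair.\<close>

lemma alternating_sum_exact:
  fixes d i j :: "nat \<Rightarrow> nat"
  shows "(\<Sum>p<N. (-1) ^ p * int (i p + j p)) =
    (\<Sum>p<N. (-1) ^ p * int (d (Suc p) + i p)) + (\<Sum>p<N. (-1) ^ p * int (j p + d p))
      - int (d 0) + (-1) ^ N * int (d N)"
  by (induction N) (auto simp: algebra_simps)

section \<open>The long exact sequence of a pair\<close>

context
  fixes X :: "'a topology" and S :: "'a set"
begin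

private abbreviation (input) "HA p \<equiv> homology_group p (subtopology X S)"
private abbreviation (input) "HX p \<equiv> homology_group p X"
private abbreviation (input) "HR p \<equiv> relative_homology_group p X S"
private abbreviation (input) "ii p \<equiv> hom_induced p (subtopology X S) {} X {} id"
private abbreviation (input) "jj p \<equiv> hom_induced p X {} X S id"
private abbreviation (input) "dd p \<equiv> hom_boundary p X S"

text \<open>This lemma and the next two are the segments centred at the space, the pair and the
  subspace. Finite ranks at both ends produce one in the middle.\<close>

lemma betti_exact_space:
  assumes "betti p (subtopology X S) {} a" "betti p X S r"
  obtains i j where "zrank (HX p) (ii p ` carrier (HA p)) i" "zrank (HR p) (jj p ` carrier (HX p)) j"
    "betti p X {} (i + j)" "i \<le> a" "j \<le> r"
  using zrank_exact[OF homology_exactness_axiom_3[of p X S]] assms unfolding betti_def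
  by (metis abelian_relative_homology_group)

lemma betti_exact_pair:
  assumes "betti p X {} x" "betti (p - 1) (subtopology X S) {} a"
  obtains j d where "zrank (HR p) (jj p ` carrier (HX p)) j"
    "zrank (HA (p - 1)) (dd p ` carrier (HR p)) d" "betti p X S (j + d)" "j \<le> x" "d \<le> a"
  using zrank_exact[OF homology_exactness_axiom_1[of p X S]] assms unfolding betti_def
  by (metis abelian_relative_homology_group)

lemma betti_exact_subspace:
  assumes "betti p X S r" "betti (p - 1) X {} x"
  obtains d i where "zrank (HA (p - 1)) (dd p ` carrier (HR p)) d"
    "zrank (HX (p - 1)) (ii (p - 1) ` carrier (HA (p - 1))) i"
    "betti (p - 1) (subtopology X S) {} (d + i)" "d \<le> r" "i \<le> x"
  using zrank_exact[OF homology_exactness_axiom_2[of p X S]] assms unfolding betti_def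
  by (metis abelian_relative_homology_group)

text \<open>Each image lies in two adjacent segments, and uniqueness of the rank identifies the
  numbers found there. \<open>d 0 = 0\<close> because the boundary map out of degree 0 ends in
  degree -1.\<close>

lemma betti_sequences:
  assumes "\<And>p::nat. betti (int p) (subtopology X S) {} (a p)" "\<And>p::nat. betti (int p) X {} (x p)"
    "\<And>p::nat. betti (int p) X S (r p)"
  obtains d i j where "\<And>p. a p = d (Suc p) + i p" "\<And>p. x p = i p + j p" "\<And>p. r p = j p + d p"
    "d 0 = 0"
proof -
  \<comment> \<open>Continued by 0 to negative degrees, where homology is trivial, so that the
    segment at the pair also makes sense for \<open>p = 0\<close>.\<close>
  have a: "betti p (subtopology X S) {} (if p < 0 then 0 else a (nat p))" for p :: int
    using assms(1)[of "nat p"] by (auto intro: betti_trivial)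
  have unique: "m = n" if "zrank (relative_homology_group p Y T) A m"
    "zrank (relative_homology_group p Y T) A n" for p T A m n and Y :: "'a topology"
    using comm_group.zrank_unique[OF abelian_relative_homology_group] that by blast
  have "\<exists>i j d. zrank (HX p) (ii p ` carrier (HA p)) i \<and> zrank (HR p) (jj p ` carrier (HX p)) j \<and>
      zrank (HA (p - 1)) (dd p ` carrier (HR p)) d \<and>
      x (nat p) = i + j \<and> r (nat p) = j + d \<and> (p = 0 \<longrightarrow> d = 0)" if "p \<ge> 0" for p :: int
  proof -
    have p: "betti p (subtopology X S) {} (a (nat p))" "betti p X {} (x (nat p))"
      "betti p X S (r (nat p))"
      using assms[of "nat p"] that by auto
    obtain i j where ij: "zrank (HX p) (ii p ` carrier (HA p)) i"
      "zrank (HR p) (jj p ` carrier (HX p)) j" "betti p X {} (i + j)"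
      using betti_exact_space[OF p(1,3)] by metis
    obtain j' d where jd: "zrank (HR p) (jj p ` carrier (HX p)) j'"
      "zrank (HA (p - 1)) (dd p ` carrier (HR p)) d" "betti p X S (j' + d)"
      "d \<le> (if p - 1 < 0 then 0 else a (nat (p - 1)))"
      using betti_exact_pair[OF p(2) a[of "p - 1"]] by metis
    have "j' = j" using unique ij(2) jd(1) by blast
    moreover have "x (nat p) = i + j" using betti_unique[OF p(2) ij(3)] .
    moreover have "r (nat p) = j' + d" using betti_unique[OF p(3) jd(3)] .
    moreover have "p = 0 \<longrightarrow> d = 0" using jd(4) by auto
    ultimately show ?thesis
      using ij(1,2) jd(2) by (intro exI[of _ i] exI[of _ j] exI[of _ d]) simp
  qed
  then have "\<exists>i j d. zrank (HX (int p)) (ii (int p) ` carrier (HA (int p))) i \<and>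
      zrank (HA (int p - 1)) (dd (int p) ` carrier (HR (int p))) d \<and>
      x p = i + j \<and> r p = j + d \<and> (p = 0 \<longrightarrow> d = 0)" for p :: nat
    by (metis nat_int of_nat_0_le_iff of_nat_eq_0_iff)
  then obtain i j d where
    i: "\<And>p. zrank (HX (int p)) (ii (int p) ` carrier (HA (int p))) (i p)" and
    d: "\<And>p. zrank (HA (int p - 1)) (dd (int p) ` carrier (HR (int p))) (d p)" and
    xr: "\<And>p. x p = i p + j p" "\<And>p. r p = j p + d p" "d 0 = 0"
    by metis
  have "a p = d (Suc p) + i p" for p
  proof -
    have "betti (int (Suc p) - 1) X {} (x p)" using assms(2)[of p] by simp
    from betti_exact_subspace[OF assms(3) this] obtain d' i' where
      d': "zrank (HA (int (Suc p) - 1)) (dd (int (Suc p)) ` carrier (HR (int (Suc p)))) d'" and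
      i': "zrank (HX (int (Suc p) - 1)) (ii (int (Suc p) - 1) ` carrier (HA (int (Suc p) - 1))) i'"
      and s: "betti (int (Suc p) - 1) (subtopology X S) {} (d' + i')" by metis
    have "d' = d (Suc p)" using unique d' d by blast
    moreover have "i' = i p" using unique i' i[of p] by simp
    moreover have "d' + i' = a p" using betti_unique s assms(1)[of p] by simp
    ultimately show ?thesis by simp
  qed
  then show thesis using that xr by blast
qed

text \<open>The rank identities telescope. Of the two leftover terms, \<open>d 0\<close> is zero by
  degree and \<open>d N\<close> is a summand of \<open>r N\<close>.\<close>

lemma euler_char_exact:
  assumes "\<And>p::nat. betti (int p) (subtopology X S) {} (a p)" "\<And>p::nat. betti (int p) X {} (x p)"
    "\<And>p::nat. betti (int p) X S (r p)" "r N = 0"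
  shows "(\<Sum>p<N. (-1) ^ p * int (x p)) =
    (\<Sum>p<N. (-1) ^ p * int (a p)) + (\<Sum>p<N. (-1) ^ p * int (r p))"
proof -
  obtain d i j where *: "\<And>p. a p = d (Suc p) + i p" "\<And>p. x p = i p + j p" "\<And>p. r p = j p + d p"
    "d 0 = 0"
    using betti_sequences[OF assms(1-3)] by metis
  show ?thesis using alternating_sum_exact[of i j N d] assms(4) * by simp
qed

lemma euler_char_space:
  assumes "euler_char (subtopology X S) {} e" "euler_char X S f"
  shows "euler_char X {} (e + f)"
proof -
  obtain a where a: "\<And>p. betti (int p) (subtopology X S) {} (a p)"
    "\<forall>\<^sub>F N in sequentially. a N = 0 \<and> (\<Sum>p<N. (-1) ^ p * int (a p)) = e"
    using assms(1) by (auto simp: euler_char_def)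
  obtain r where r: "\<And>p. betti (int p) X S (r p)"
    "\<forall>\<^sub>F N in sequentially. r N = 0 \<and> (\<Sum>p<N. (-1) ^ p * int (r p)) = f"
    using assms(2) by (auto simp: euler_char_def)
  have "\<exists>x. betti (int p) X {} x \<and> x \<le> a p + r p" for p
    using betti_exact_space[OF a(1) r(1)] by (metis add_mono)
  then obtain x where x: "\<And>p. betti (int p) X {} (x p)" "\<And>p. x p \<le> a p + r p" by metis
  have "\<forall>\<^sub>F N in sequentially. x N = 0 \<and> (\<Sum>p<N. (-1) ^ p * int (x p)) = e + f"
    using a(2) r(2)
  proof eventually_elim
    case (elim N)
    then show ?case using euler_char_exact[OF a(1) x(1) r(1), of N] x(2)[of N] by auto
  qed
  then show ?thesis unfolding euler_char_def using x(1) by blast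
qed

lemma euler_char_pair:
  assumes "euler_char (subtopology X S) {} e" "euler_char X {} f"
  shows "euler_char X S (f - e)"
proof -
  obtain a where a: "\<And>p. betti (int p) (subtopology X S) {} (a p)"
    "\<forall>\<^sub>F N in sequentially. a N = 0 \<and> (\<Sum>p<N. (-1) ^ p * int (a p)) = e"
    using assms(1) by (auto simp: euler_char_def)
  obtain x where x: "\<And>p. betti (int p) X {} (x p)"
    "\<forall>\<^sub>F N in sequentially. x N = 0 \<and> (\<Sum>p<N. (-1) ^ p * int (x p)) = f"
    using assms(2) by (auto simp: euler_char_def)
  \<comment> \<open>In degree \<open>p\<close> the pair is bounded by the subspace in degree
    \<open>p - 1\<close>. The separate value at 0 stands for homology in degree -1, where natural
    subtraction would give \<open>a 0\<close>.\<close>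
  define a' where "a' p = (if p = 0 then 0 else a (p - 1))" for p :: nat
  have a': "betti (int p - 1) (subtopology X S) {} (a' p)" for p
    using a(1)[of "p - 1"] by (cases p) (auto simp: a'_def intro: betti_trivial)
  have "\<exists>r. betti (int p) X S r \<and> r \<le> x p + a' p" for p
    using betti_exact_pair[OF x(1) a'(1)] by (metis add_mono)
  then obtain r where r: "\<And>p. betti (int p) X S (r p)" "\<And>p. r p \<le> x p + a' p" by metis
  have "\<forall>\<^sub>F N in sequentially. a (N - 1) = 0"
  proof -
    obtain M where "\<And>N. N \<ge> M \<Longrightarrow> a N = 0"
      using a(2) by (auto simp: eventually_sequentially)
    then show ?thesis by (intro eventually_sequentiallyI[of "Suc M"]) auto
  qed
  with a(2) x(2) have "\<forall>\<^sub>F N in sequentially. r N = 0 \<and> (\<Sum>p<N. (-1) ^ p * int (r p)) = f - e"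
  proof eventually_elim
    case (elim N)
    then have "r N = 0" using r(2)[of N] by (simp add: a'_def split: if_splits)
    then show ?case using euler_char_exact[OF a(1) x(1) r(1), of N] elim by auto
  qed
  then show ?thesis unfolding euler_char_def using r(1) by blast
qed

end

text \<open>A substitute for Mayer-Vietoris: excision identifies the pair (X, U) with (V, U \<inter>
  V), and both pairs have long exact sequences. As \<open>V\<close> is open and the sets cover, the
  excised complement of \<open>V\<close> is closed and contained in the open set
  \<open>U\<close>.\<close>

lemma euler_char_open_cover:
  assumes "openin X U" "openin X V" "U \<union> V = topspace X"
    "euler_char (subtopology X U) {} e" "euler_char (subtopology X V) {} f"
    "euler_char (subtopology X (U \<inter> V)) {} g"
  shows "euler_char X {} (e + f - g)"
proof -
  have sub: "subtopology (subtopology X V) (U \<inter> V) = subtopology X (U \<inter> V)"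
    by (simp add: subtopology_subtopology Int_ac)
  have "euler_char (subtopology X V) (U \<inter> V) (f - g)"
    by (rule euler_char_pair) (use assms sub in simp_all)
  moreover have "relative_homology_group p X U \<cong> relative_homology_group p (subtopology X V) (U \<inter> V)"
    for p
  proof -
    define W where "W = topspace X - V"
    have "closedin X W" using assms by (auto simp: W_def)
    then have "X closure_of W \<subseteq> X interior_of U"
      using assms by (auto simp: closure_of_closedin interior_of_openin W_def)
    moreover have "U \<subseteq> topspace X" "V \<subseteq> topspace X" using assms openin_subset by auto
    ultimately have "relative_homology_group p (subtopology X (topspace X - W)) (U - W)
        \<cong> relative_homology_group p (subtopology X (topspace X)) U"
      using homology_excision_axiom[of X W U "topspace X" p] unfolding is_iso_def by blast
    moreover have "topspace X - W = V" "U - W = U \<inter> V"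
      using \<open>V \<subseteq> topspace X\<close> \<open>U \<subseteq> topspace X\<close> by (auto simp: W_def)
    ultimately show ?thesis
      by (simp add: group.iso_sym)
  qed
  ultimately have "euler_char X U (f - g)" using euler_char_iso by blast
  from euler_char_space[OF assms(4) this] show ?thesis by (simp add: algebra_simps)
qed

section \<open>Deletion and link of a vertex\<close>

lemma complexD:
  assumes "finite_simplicial_complex F"
  shows "finite F" "\<sigma> \<in> F \<Longrightarrow> finite \<sigma>" "\<sigma> \<in> F \<Longrightarrow> \<sigma> \<noteq> {}"
    "\<sigma> \<in> F \<Longrightarrow> \<tau> \<subseteq> \<sigma> \<Longrightarrow> \<tau> \<noteq> {} \<Longrightarrow> \<tau> \<in> F"
  using assms unfolding finite_simplicial_complex_def by blast+

lemma finite_simplicial_complexI: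
  assumes "finite F" "\<And>\<sigma>. \<sigma> \<in> F \<Longrightarrow> finite \<sigma>" "\<And>\<sigma>. \<sigma> \<in> F \<Longrightarrow> \<sigma> \<noteq> {}"
    "\<And>\<sigma> \<tau>. \<sigma> \<in> F \<Longrightarrow> \<tau> \<subseteq> \<sigma> \<Longrightarrow> \<tau> \<noteq> {} \<Longrightarrow> \<tau> \<in> F"
  shows "finite_simplicial_complex F"
  unfolding finite_simplicial_complex_def using assms by blast

section \<open>Points and homotopies in barycentric coordinates\<close>

definition realization_points :: "'a set set \<Rightarrow> ('a \<Rightarrow> real) set" where
  "realization_points F =
     {x. (\<forall>v. 0 \<le> x v) \<and> {v. x v \<noteq> 0} \<in> F \<and> (\<Sum>v | x v \<noteq> 0. x v) = 1}"

abbreviation point_space :: "('a \<Rightarrow> real) set \<Rightarrow> ('a \<Rightarrow> real) topology" where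
  "point_space A \<equiv> subtopology (powertop_real UNIV) A"

lemma geometric_realization_eq: "geometric_realization F = point_space (realization_points F)"
  by (simp add: geometric_realization_def realization_points_def)

lemma topspace_realization [simp]: "topspace (geometric_realization F) = realization_points F"
  by (simp add: geometric_realization_eq)

text \<open>The support may be a proper part of \<open>\<sigma>\<close>. Thus a whole segment can be
  checked on one fixed face, although supports shrink at its ends.\<close>

lemma realization_pointsI:
  assumes F: "finite_simplicial_complex F" and "\<sigma> \<in> F" "\<And>w. 0 \<le> x w"
    and 0: "\<And>w. w \<notin> \<sigma> \<Longrightarrow> x w = 0" and "sum x \<sigma> = 1"
  shows "x \<in> realization_points F"
proof -
  have fin: "finite \<sigma>" using complexD(2)[OF F] assms by simp
  have "{v. x v \<noteq> 0} \<subseteq> \<sigma>" using 0 by auto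
  moreover from this have sum: "(\<Sum>v | x v \<noteq> 0. x v) = sum x \<sigma>"
    using fin by (intro sum.mono_neutral_left) auto
  moreover have "{v. x v \<noteq> 0} \<noteq> {}"
  proof
    assume "{v. x v \<noteq> 0} = {}"
    then show False using sum assms(5) by simp
  qed
  ultimately have "{v. x v \<noteq> 0} \<in> F"
    using complexD(4)[OF F \<open>\<sigma> \<in> F\<close>] by simp
  with sum assms show ?thesis by (simp add: realization_points_def)
qed

lemma realization_pointsE:
  assumes F: "finite_simplicial_complex F" and x: "x \<in> realization_points F"
  obtains \<sigma> where "\<sigma> \<in> F" "finite \<sigma>" "\<forall>w. 0 \<le> x w" "\<forall>w. w \<notin> \<sigma> \<longrightarrow> x w = 0"
    "\<forall>w\<in>\<sigma>. x w > 0" "sum x \<sigma> = 1"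
proof (rule that[of "{v. x v \<noteq> 0}"])
  note x = x[unfolded realization_points_def mem_Collect_eq]
  show "{v. x v \<noteq> 0} \<in> F" using x by simp
  then show "finite {v. x v \<noteq> 0}" by (rule complexD(2)[OF F])
  show "\<forall>w\<in>{v. x v \<noteq> 0}. x w > 0" using x by (auto simp: less_le)
  show "\<forall>w. 0 \<le> x w" "sum x {v. x v \<noteq> 0} = 1" using x by auto
qed simp

lemma continuous_map_coordinate [continuous_intros]:
  "continuous_map (point_space A) euclideanreal (\<lambda>x. x w)"
  by (intro continuous_map_from_subtopology continuous_map_product_projection) simp

text \<open>A realization is rarely convex, so the hypothesis concerns just the segments from
  \<open>f x\<close> to \<open>x\<close>; in the applications both ends lie in a common closed
  simplex.\<close>

lemma homotopic_straight_line:
  assumes f: "continuous_map (point_space A) (point_space A) f"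
    and line: "\<And>t x. 0 \<le> t \<Longrightarrow> t \<le> 1 \<Longrightarrow> x \<in> A \<Longrightarrow> (\<lambda>w. (1 - t) * f x w + t * x w) \<in> A"
  shows "homotopic_with (\<lambda>_. True) (point_space A) (point_space A) f id"
proof -
  let ?P = "prod_topology (top_of_set {0..1::real}) (point_space A)"
  let ?h = "\<lambda>z w. (1 - fst z) * f (snd z) w + fst z * snd z w"
  have t: "continuous_map ?P euclideanreal fst"
    using continuous_map_fst continuous_map_in_subtopology by blast
  have x: "continuous_map ?P euclideanreal (\<lambda>z. snd z w)" for w
    using continuous_map_compose[OF continuous_map_snd continuous_map_coordinate[of A w]]
    by (simp add: o_def)
  have "continuous_map (point_space A) euclideanreal (\<lambda>x. f x w)" for w
    using continuous_map_compose[OF f continuous_map_coordinate[of A w]] by (simp add: o_def)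
  from continuous_map_compose[OF continuous_map_snd this]
  have fx: "continuous_map ?P euclideanreal (\<lambda>z. f (snd z) w)" for w
    by (simp add: o_def)
  have "continuous_map ?P (powertop_real UNIV) ?h"
    unfolding continuous_map_componentwise_UNIV by (intro allI continuous_intros t x fx) simp_all
  moreover have "?h \<in> topspace ?P \<rightarrow> A"
    using line by auto
  ultimately have "continuous_map ?P (point_space A) ?h"
    by (simp add: continuous_map_in_subtopology image_subset_iff Pi_iff)
  then show ?thesis
    unfolding homotopic_with_def by (intro exI[of _ ?h]) auto
qed

lemma euler_char_star_shaped:
  assumes "a \<in> A" and line: "\<And>t x. 0 \<le> t \<Longrightarrow> t \<le> 1 \<Longrightarrow> x \<in> A \<Longrightarrow> (\<lambda>w. (1 - t) * a w + t * x w) \<in> A"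
  shows "euler_char (point_space A) {} 1"
proof -
  have "homotopic_with (\<lambda>_. True) (point_space A) (point_space A) (\<lambda>_. a) id"
    by (rule homotopic_straight_line) (use assms in auto)
  then have "contractible_space (point_space A)"
    unfolding contractible_space_def using homotopic_with_sym by blast
  \<comment> \<open>Rules out the empty space, which is contractible in this sense but has Euler
    characteristic 0.\<close>
  moreover have "point_space A \<noteq> trivial_topology"
    using assms(1) null_topspace_iff_trivial[of "point_space A"] by auto
  ultimately have "\<exists>b\<in>topspace (point_space A). point_space A homotopy_equivalent_space subtopology (point_space A) {b}"
    using contractible_eq_homotopy_equivalent_singleton_subtopology by blast
  then obtain b where "point_space A homotopy_equivalent_space subtopology (point_space A) {b}" "b \<in> A"
    by auto
  moreover from this have "euler_char (subtopology (point_space A) {b}) {} 1"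
    by (intro euler_char_singleton[of _ b]) auto
  ultimately show ?thesis using euler_char_homotopy_equivalent by blast
qed

definition deletion :: "'a \<Rightarrow> 'a set set \<Rightarrow> 'a set set" where
  "deletion v F = {\<sigma> \<in> F. v \<notin> \<sigma>}"

definition link :: "'a \<Rightarrow> 'a set set \<Rightarrow> 'a set set" where
  "link v F = {\<sigma> \<in> F. v \<notin> \<sigma> \<and> insert v \<sigma> \<in> F}"

lemma finite_simplicial_complex_deletion:
  assumes F: "finite_simplicial_complex F"
  shows "finite_simplicial_complex (deletion v F)"
proof (rule finite_simplicial_complexI)
  show "finite (deletion v F)" using complexD(1)[OF F] by (simp add: deletion_def)
next
  fix \<sigma> \<tau> assume "\<sigma> \<in> deletion v F" "\<tau> \<subseteq> \<sigma>" "\<tau> \<noteq> {}"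
  then show "\<tau> \<in> deletion v F" using complexD(4)[OF F, of \<sigma> \<tau>] by (auto simp: deletion_def)
next
  fix \<sigma> assume "\<sigma> \<in> deletion v F"
  then have "\<sigma> \<in> F" by (simp add: deletion_def)
  then show "finite \<sigma>" "\<sigma> \<noteq> {}" by (rule complexD[OF F])+
qed

lemma finite_simplicial_complex_link:
  assumes F: "finite_simplicial_complex F"
  shows "finite_simplicial_complex (link v F)"
proof (rule finite_simplicial_complexI)
  show "finite (link v F)" using complexD(1)[OF F] by (simp add: link_def)
next
  fix \<sigma> \<tau> assume "\<sigma> \<in> link v F" "\<tau> \<subseteq> \<sigma>" "\<tau> \<noteq> {}"
  then show "\<tau> \<in> link v F"
    using complexD(4)[OF F, of \<sigma> \<tau>] complexD(4)[OF F, of "insert v \<sigma>" "insert v \<tau>"]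
    by (auto simp: link_def)
next
  fix \<sigma> assume "\<sigma> \<in> link v F"
  then have "\<sigma> \<in> F" by (simp add: link_def)
  then show "finite \<sigma>" "\<sigma> \<noteq> {}" by (rule complexD[OF F])+
qed

text \<open>Radial projection from the vertex \<open>v\<close> onto the opposite face: after
  dropping the coordinate at \<open>v\<close> the others sum to \<open>1 - x v\<close> and are
  rescaled.\<close>

definition project :: "'a \<Rightarrow> ('a \<Rightarrow> real) \<Rightarrow> 'a \<Rightarrow> real" where
  "project v x w = (if w = v then 0 else x w / (1 - x v))"

lemma continuous_map_project:
  assumes "\<And>x. x \<in> A \<Longrightarrow> x v < 1" "\<And>x. x \<in> A \<Longrightarrow> project v x \<in> B"
  shows "continuous_map (point_space A) (point_space B) (project v)"
proof -
  have "x v \<noteq> 1" if "x \<in> A" for x using assms(1)[OF that] by simp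
  then have "continuous_map (point_space A) euclideanreal (\<lambda>x. project v x w)" for w
    by (cases "w = v") (auto simp: project_def intro!: continuous_intros)
  then show ?thesis
    using assms(2) by (auto simp: continuous_map_in_subtopology continuous_map_componentwise_UNIV)
qed

section \<open>The open cover at a vertex\<close>

locale complex_vertex =
  fixes F :: "'a set set" and v :: 'a
  assumes complex: "finite_simplicial_complex F" and vertex: "{v} \<in> F"
begin

lemma face_subset: "\<sigma> \<in> F \<Longrightarrow> \<tau> \<subseteq> \<sigma> \<Longrightarrow> \<tau> \<noteq> {} \<Longrightarrow> \<tau> \<in> F"
  by (rule complexD(4)[OF complex])

text \<open>Positivity of \<open>x v\<close> puts \<open>v\<close> into the face carrying
  \<open>x\<close>, so removing \<open>v\<close> leaves a face of the link; \<open>x v < 1\<close>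
  ensures that something is left.\<close>

lemma project_in_link:
  assumes x: "x \<in> realization_points F" "0 < x v" "x v < 1"
  shows "project v x \<in> realization_points (link v F)"
proof -
  obtain \<sigma> where \<sigma>: "\<sigma> \<in> F" "finite \<sigma>" "\<forall>w. 0 \<le> x w" "\<forall>w. w \<notin> \<sigma> \<longrightarrow> x w = 0"
    "\<forall>w\<in>\<sigma>. x w > 0" "sum x \<sigma> = 1"
    by (rule realization_pointsE[OF complex x(1)])
  have v: "v \<in> \<sigma>" using \<sigma>(4) x by force
  have sum: "sum x (\<sigma> - {v}) = 1 - x v" using \<sigma> v by (simp add: sum_diff1)
  have "\<sigma> - {v} \<noteq> {}"
  proof
    assume "\<sigma> - {v} = {}"
    from sum[unfolded this] x show False by simp
  qed
  then have "\<sigma> - {v} \<in> link v F"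
    using \<sigma> v face_subset by (auto simp: link_def insert_absorb)
  moreover have "sum (project v x) (\<sigma> - {v}) = (\<Sum>w\<in>\<sigma> - {v}. x w / (1 - x v))"
    by (intro sum.cong) (auto simp: project_def)
  ultimately show ?thesis
    using x \<sigma> sum
    by (intro realization_pointsI[OF finite_simplicial_complex_link[OF complex]])
      (auto simp: project_def simp flip: sum_divide_distrib)
qed

lemma project_in_deletion:
  assumes x: "x \<in> realization_points F" "x v < 1"
  shows "project v x \<in> realization_points (deletion v F)"
proof -
  obtain \<sigma> where \<sigma>: "\<sigma> \<in> F" "finite \<sigma>" "\<forall>w. 0 \<le> x w" "\<forall>w. w \<notin> \<sigma> \<longrightarrow> x w = 0"
    "\<forall>w\<in>\<sigma>. x w > 0" "sum x \<sigma> = 1"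
    by (rule realization_pointsE[OF complex x(1)])
  have sum: "sum x (\<sigma> - {v}) = 1 - x v" using \<sigma> by (simp add: sum_diff1)
  have "\<sigma> - {v} \<noteq> {}"
  proof
    assume "\<sigma> - {v} = {}"
    from sum[unfolded this] x show False by simp
  qed
  then have "\<sigma> - {v} \<in> deletion v F"
    using \<sigma> face_subset by (auto simp: deletion_def)
  moreover have "sum (project v x) (\<sigma> - {v}) = (\<Sum>w\<in>\<sigma> - {v}. x w / (1 - x v))"
    by (intro sum.cong) (auto simp: project_def)
  ultimately show ?thesis
    using x \<sigma> sum
    by (intro realization_pointsI[OF finite_simplicial_complex_deletion[OF complex]])
      (auto simp: project_def simp flip: sum_divide_distrib)
qed

text \<open>A point and its projection lie in a common closed simplex, so the segment between them
  stays in F. On it the coordinate at \<open>v\<close> is \<open>t * x v\<close>, which remains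
  below 1.\<close>

lemma deletion_homotopy_equivalent:
  "point_space {x \<in> realization_points F. x v < 1} homotopy_equivalent_space
     geometric_realization (deletion v F)"
proof -
  let ?A = "{x \<in> realization_points F. x v < 1}" and ?B = "realization_points (deletion v F)"
  have B: "x v = 0" "x \<in> realization_points F" if "x \<in> ?B" for x
    using that by (auto simp: deletion_def realization_points_def)
  have f: "continuous_map (point_space ?A) (point_space ?B) (project v)"
    by (rule continuous_map_project) (use project_in_deletion in blast)+
  have g: "continuous_map (point_space ?B) (point_space ?A) id"
  proof -
    have "?B \<subseteq> ?A" using B by force
    then show ?thesis by (auto simp: continuous_map_in_subtopology intro: continuous_map_from_subtopology)
  qed
  have "(\<lambda>w. (1 - t) * project v x w + t * x w) \<in> ?A" if t: "0 \<le> t" "t \<le> 1" and x: "x \<in> ?A" for t x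
  proof -
    have "x \<in> realization_points F" using x by simp
    then obtain \<sigma> where \<sigma>: "\<sigma> \<in> F" "finite \<sigma>" "\<forall>w. 0 \<le> x w" "\<forall>w. w \<notin> \<sigma> \<longrightarrow> x w = 0"
      "\<forall>w\<in>\<sigma>. x w > 0" "sum x \<sigma> = 1"
      by (rule realization_pointsE[OF complex])
    have "sum (project v x) \<sigma> = (\<Sum>w\<in>\<sigma> - {v}. x w / (1 - x v))"
      using \<sigma>(2) by (intro sum.mono_neutral_cong_right) (auto simp: project_def)
    also have "\<dots> = 1" using \<sigma> x by (simp add: sum_diff1 flip: sum_divide_distrib)
    finally have "(\<Sum>w\<in>\<sigma>. (1 - t) * project v x w + t * x w) = 1"
      using \<sigma>(6) by (simp add: sum.distrib flip: sum_distrib_left)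
    moreover have "(1 - t) * project v x v + t * x v < 1"
      using t x mult_left_le_one_le[of "x v" t] \<sigma>(3) by (auto simp: project_def)
    ultimately show ?thesis
      using t x \<sigma> by (auto intro!: realization_pointsI[OF complex \<sigma>(1)] simp: project_def)
  qed
  then have "homotopic_with (\<lambda>_. True) (point_space ?A) (point_space ?A) (id \<circ> project v) id"
    by (intro homotopic_straight_line continuous_map_compose[OF f g]) auto
  moreover have "homotopic_with (\<lambda>_. True) (point_space ?B) (point_space ?B) (project v \<circ> id) id"
  proof (intro homotopic_with_equal continuous_map_compose[OF g f])
    fix x assume "x \<in> topspace (point_space ?B)"
    then have "x v = 0" using B(1) by simp
    then show "(project v \<circ> id) x = id x" by (auto simp: project_def)
  qed auto
  ultimately show ?thesis
    unfolding homotopy_equivalent_space_def geometric_realization_eq using f g by blast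
qed

text \<open>The set is the cone over the link without apex and base. The homotopy keeps the
  projection to the link and moves only the height \<open>x v\<close>, linearly from 1/2.\<close>

lemma link_homotopy_equivalent:
  "point_space {x \<in> realization_points F. 0 < x v \<and> x v < 1} homotopy_equivalent_space
     geometric_realization (link v F)"
proof -
  let ?A = "{x \<in> realization_points F. 0 < x v \<and> x v < 1}" and ?B = "realization_points (link v F)"
  \<comment> \<open>Embeds the link halfway up the cone; any height strictly between 0 and 1 would
    serve.\<close>
  define g :: "('a \<Rightarrow> real) \<Rightarrow> 'a \<Rightarrow> real" where "g y w = (if w = v then 1 / 2 else y w / 2)" for y w
  have f: "continuous_map (point_space ?A) (point_space ?B) (project v)"
    by (rule continuous_map_project) (use project_in_link in blast)+
  have Bv: "y v = 0" if "y \<in> ?B" for y using that by (auto simp: link_def realization_points_def)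
  have gA: "g y \<in> ?A" if y: "y \<in> ?B" for y
  proof -
    obtain \<sigma> where \<sigma>: "\<sigma> \<in> link v F" "finite \<sigma>" "\<forall>w. 0 \<le> y w" "\<forall>w. w \<notin> \<sigma> \<longrightarrow> y w = 0"
      "\<forall>w\<in>\<sigma>. y w > 0" "sum y \<sigma> = 1"
      by (rule realization_pointsE[OF finite_simplicial_complex_link[OF complex] y])
    have v: "v \<notin> \<sigma>" "insert v \<sigma> \<in> F" using \<sigma> by (auto simp: link_def)
    have "sum (g y) \<sigma> = sum (\<lambda>w. y w / 2) \<sigma>" using v by (intro sum.cong) (auto simp: g_def)
    then have "sum (g y) (insert v \<sigma>) = 1"
      using v \<sigma> by (simp add: g_def flip: sum_divide_distrib)
    then have "g y \<in> realization_points F"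
      using \<sigma> v by (intro realization_pointsI[OF complex v(2)]) (auto simp: g_def)
    then show ?thesis by (simp add: g_def)
  qed
  have "continuous_map (point_space ?B) euclideanreal (\<lambda>y. g y w)" for w
    by (cases "w = v") (auto simp: g_def intro!: continuous_intros)
  then have g: "continuous_map (point_space ?B) (point_space ?A) g"
    using gA by (auto simp: continuous_map_in_subtopology continuous_map_componentwise_UNIV)
  have "(\<lambda>w. (1 - t) * g (project v x) w + t * x w) \<in> ?A" if t: "0 \<le> t" "t \<le> 1" and x: "x \<in> ?A" for t x
  proof -
    have "x \<in> realization_points F" using x by simp
    then obtain \<sigma> where \<sigma>: "\<sigma> \<in> F" "finite \<sigma>" "\<forall>w. 0 \<le> x w" "\<forall>w. w \<notin> \<sigma> \<longrightarrow> x w = 0"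
      "\<forall>w\<in>\<sigma>. x w > 0" "sum x \<sigma> = 1"
      by (rule realization_pointsE[OF complex])
    have v: "v \<in> \<sigma>" using \<sigma>(4) x by force
    have "sum (g (project v x)) \<sigma> = g (project v x) v + sum (g (project v x)) (\<sigma> - {v})"
      using \<sigma>(2) v by (simp add: sum.remove)
    also have "sum (g (project v x)) (\<sigma> - {v}) = (\<Sum>w\<in>\<sigma> - {v}. x w / (1 - x v) / 2)"
      by (intro sum.cong) (auto simp: project_def g_def)
    also have "\<dots> = 1 / 2" using \<sigma> v x by (simp add: sum_diff1 flip: sum_divide_distrib)
    finally have "(\<Sum>w\<in>\<sigma>. (1 - t) * g (project v x) w + t * x w) = 1"
      using \<sigma>(6) by (simp add: sum.distrib g_def flip: sum_distrib_left)
    moreover have "0 < (1 - t) * (1 / 2) + t * x v \<and> (1 - t) * (1 / 2) + t * x v < 1"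
    proof (cases "t = 0")
      case False
      then have "0 < t * x v" "t * x v < t" using x t by auto
      with t show ?thesis by (simp add: field_simps)
    qed simp
    ultimately show ?thesis
      using t x \<sigma> v by (auto intro!: realization_pointsI[OF complex \<sigma>(1)] simp: project_def g_def)
  qed
  then have "homotopic_with (\<lambda>_. True) (point_space ?A) (point_space ?A) (g \<circ> project v) id"
    by (intro homotopic_straight_line continuous_map_compose[OF f g]) auto
  moreover have "homotopic_with (\<lambda>_. True) (point_space ?B) (point_space ?B) (project v \<circ> g) id"
  proof (intro homotopic_with_equal continuous_map_compose[OF g f])
    fix x assume "x \<in> topspace (point_space ?B)"
    then have "x v = 0" using Bv by simp
    then show "(project v \<circ> g) x = id x" by (auto simp: project_def g_def)
  qed auto
  ultimately show ?thesis
    unfolding homotopy_equivalent_space_def geometric_realization_eq using f g by blast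
qed

text \<open>The face carrying such a point contains \<open>v\<close>, so the set is star-shaped
  around the vertex.\<close>

lemma euler_char_open_star: "euler_char (point_space {x \<in> realization_points F. 0 < x v}) {} 1"
proof (rule euler_char_star_shaped[of "\<lambda>w. if w = v then 1 else 0"])
  have "(\<lambda>w. if w = v then 1 else 0) \<in> realization_points F"
    by (intro realization_pointsI[OF complex vertex]) auto
  then show "(\<lambda>w. if w = v then 1 else 0) \<in> {x \<in> realization_points F. 0 < x v}" by simp
next
  fix t :: real and x assume t: "0 \<le> t" "t \<le> 1" and x: "x \<in> {x \<in> realization_points F. 0 < x v}"
  have "x \<in> realization_points F" using x by simp
  then obtain \<sigma> where \<sigma>: "\<sigma> \<in> F" "finite \<sigma>" "\<forall>w. 0 \<le> x w" "\<forall>w. w \<notin> \<sigma> \<longrightarrow> x w = 0"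
    "\<forall>w\<in>\<sigma>. x w > 0" "sum x \<sigma> = 1"
    by (rule realization_pointsE[OF complex])
  have v: "v \<in> \<sigma>" using \<sigma>(4) x by force
  have "(\<Sum>w\<in>\<sigma>. (1 - t) * (if w = v then 1 else 0) + t * x w) = 1"
    using \<sigma> v by (simp add: sum.distrib flip: sum_distrib_left)
  moreover have "0 < (1 - t) + t * x v"
    using t x by (cases "t = 1") (auto intro: add_pos_nonneg)
  ultimately show "(\<lambda>w. (1 - t) * (if w = v then 1 else 0) + t * x w)
      \<in> {x \<in> realization_points F. 0 < x v}"
    using t \<sigma> v by (auto intro!: realization_pointsI[OF complex \<sigma>(1)])
qed

lemma euler_char_deletion_link:
  assumes "euler_char (geometric_realization (deletion v F)) {} d"
    "euler_char (geometric_realization (link v F)) {} l"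
  shows "euler_char (geometric_realization F) {} (d + 1 - l)"
proof -
  let ?X = "geometric_realization F"
  let ?U = "{x \<in> realization_points F. x v < 1}" and ?V = "{x \<in> realization_points F. 0 < x v}"
  have sub: "subtopology ?X A = point_space A" if "A \<subseteq> realization_points F" for A
    using that by (simp add: geometric_realization_eq subtopology_subtopology Int_absorb1)
  have cont: "continuous_map ?X euclideanreal (\<lambda>x. x v)"
    unfolding geometric_realization_eq by (rule continuous_map_coordinate)
  have "openin ?X ?U" "openin ?X ?V"
    using openin_continuous_map_preimage[OF cont, of "{..<1}"]
      openin_continuous_map_preimage[OF cont, of "{0<..}"] by simp_all
  moreover have "?U \<union> ?V = topspace ?X" by auto
  moreover have "euler_char (subtopology ?X ?U) {} d"
    using euler_char_homotopy_equivalent[OF deletion_homotopy_equivalent assms(1)]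
    by (subst sub) auto
  moreover have "euler_char (subtopology ?X ?V) {} 1"
    using euler_char_open_star by (subst sub) auto
  moreover have "?U \<inter> ?V = {x \<in> realization_points F. 0 < x v \<and> x v < 1}" by auto
  then have "euler_char (subtopology ?X (?U \<inter> ?V)) {} l"
    using euler_char_homotopy_equivalent[OF link_homotopy_equivalent assms(2)]
    by (subst sub) auto
  ultimately show ?thesis by (rule euler_char_open_cover)
qed

end

section \<open>Barycentric subdivision of a simplex\<close>

lemma chi_eq_sum_faces:
  assumes F: "finite_simplicial_complex F"
  shows "chi \<gamma> F = (\<Sum>\<sigma>\<in>F. fps_nth \<gamma> (card \<sigma> - 1))"
proof -
  have fin: "finite F" by (rule complexD(1)[OF F])
  have pos: "card \<sigma> > 0" if "\<sigma> \<in> F" for \<sigma>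
    using complexD(2,3)[OF F that] by (simp add: card_gt_0_iff)
  have dim: "card \<sigma> - 1 \<le> complex_dim F" if "\<sigma> \<in> F" for \<sigma>
    unfolding complex_dim_def using that fin by (intro cSUP_upper) auto
  have "chi \<gamma> F = (\<Sum>k\<le>complex_dim F. \<Sum>\<sigma>\<in>{\<sigma> \<in> F. card \<sigma> - 1 = k}. fps_nth \<gamma> (card \<sigma> - 1))"
    unfolding chi_def
  proof (intro sum.cong refl)
    fix k
    \<comment> \<open>Faces are nonempty, so the truncated subtraction does not merge sizes 0 and
      1.\<close>
    have "{\<sigma> \<in> F. card \<sigma> = k + 1} = {\<sigma> \<in> F. card \<sigma> - 1 = k}" using pos by force
    then show "fps_nth \<gamma> k * of_nat (num_faces k F) =
        (\<Sum>\<sigma>\<in>{\<sigma> \<in> F. card \<sigma> - 1 = k}. fps_nth \<gamma> (card \<sigma> - 1))"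
      by (simp add: num_faces_def mult.commute)
  qed
  also have "\<dots> = (\<Sum>\<sigma>\<in>F. fps_nth \<gamma> (card \<sigma> - 1))"
    using fin dim by (intro sum.group) auto
  finally show ?thesis .
qed

text \<open>The combinatorial Euler characteristic, kept in the integers so that it can be compared
  with homology and also mapped into any field.\<close>

definition alternating_faces :: "'a set set \<Rightarrow> int" where
  "alternating_faces F = (\<Sum>\<sigma>\<in>F. (-1) ^ (card \<sigma> - 1))"

context complex_vertex
begin

text \<open>A face through \<open>v\<close> other than \<open>{v}\<close> is the cone over a unique
  face of the link. The vertex is a summand of its own because its base, the empty face, is not
  listed in the link.\<close>

lemma sum_faces:
  "sum h F = sum h (deletion v F) + h {v} + (\<Sum>\<sigma>\<in>link v F. h (insert v \<sigma>))"
    for h :: "'a set \<Rightarrow> 'c::comm_monoid_add"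
proof -
  have fin: "finite F" by (rule complexD(1)[OF complex])
  have split: "F = deletion v F \<union> insert {v} (insert v ` link v F)"
  proof (intro Set.set_eqI iffI)
    fix \<sigma> assume \<sigma>: "\<sigma> \<in> F"
    show "\<sigma> \<in> deletion v F \<union> insert {v} (insert v ` link v F)"
    proof (cases "v \<in> \<sigma> \<and> \<sigma> \<noteq> {v}")
      case True
      then have "\<sigma> - {v} \<in> link v F" "\<sigma> = insert v (\<sigma> - {v})"
        using \<sigma> face_subset[OF \<sigma>, of "\<sigma> - {v}"] by (auto simp: link_def insert_absorb)
      then show ?thesis by blast
    next
      case False
      then show ?thesis using \<sigma> by (auto simp: deletion_def)
    qed
  qed (use vertex in \<open>auto simp: deletion_def link_def\<close>)
  have inj: "inj_on (insert v) (link v F)"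
    by (rule inj_onI) (auto simp: link_def insert_ident)
  have "sum h F = sum h (deletion v F) + sum h (insert {v} (insert v ` link v F))"
    by (subst split, rule sum.union_disjoint)
      (use fin in \<open>auto simp: deletion_def link_def\<close>)
  also have "sum h (insert {v} (insert v ` link v F)) = h {v} + sum h (insert v ` link v F)"
    using fin complexD(3)[OF complex] by (intro sum.insert) (auto simp: link_def)
  finally show ?thesis using inj by (simp add: sum.reindex o_def add.assoc)
qed

lemma alternating_faces_deletion_link:
  "alternating_faces F = alternating_faces (deletion v F) + 1 - alternating_faces (link v F)"
proof -
  have "(-1::int) ^ (card (insert v \<sigma>) - 1) = - ((-1) ^ (card \<sigma> - 1))" if "\<sigma> \<in> link v F" for \<sigma>
  proof -
    have "finite \<sigma>" "\<sigma> \<noteq> {}" "v \<notin> \<sigma>"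
      using that complexD(2,3)[OF complex] by (auto simp: link_def)
    moreover from this obtain k where "card \<sigma> = Suc k" by (cases "card \<sigma>") auto
    ultimately show ?thesis by simp
  qed
  then show ?thesis
    unfolding alternating_faces_def by (subst sum_faces) (simp add: sum_negf)
qed

text \<open>The hypothesis says that the complex is a cone with apex \<open>v\<close>. Simplices and
  their barycentric subdivisions are of this kind, so their counts come without enumerating
  faces.\<close>

lemma alternating_faces_cone: "deletion v F = link v F \<Longrightarrow> alternating_faces F = 1"
  using alternating_faces_deletion_link by simp

end

theorem euler_char_geometric_realization:
  assumes "finite_simplicial_complex F"
  shows "euler_char (geometric_realization F) {} (alternating_faces F)"
  using assms
proof (induction "card F" arbitrary: F rule: less_induct)
  case less
  note F = complexD[OF less.prems]
  show ?case
  proof (cases "F = {}")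
    case True
    have "topspace (geometric_realization F) = {}"
      unfolding topspace_realization realization_points_def True by simp
    moreover have "alternating_faces F = 0" unfolding alternating_faces_def True by simp
    ultimately show ?thesis using euler_char_empty by metis
  next
    case False
    then obtain \<sigma> where \<sigma>: "\<sigma> \<in> F" by auto
    then obtain v where "v \<in> \<sigma>" using F(3)[OF \<sigma>] by auto
    then have "{v} \<subseteq> \<sigma>" by simp
    then have v: "{v} \<in> F" by (rule F(4)[OF \<sigma>]) (rule insert_not_empty)
    interpret complex_vertex F v by (rule complex_vertex.intro[OF less.prems v])
    \<comment> \<open>Neither contains the face \<open>{v}\<close>, which makes the induction on the
      number of faces applicable to both.\<close>
    have "deletion v F \<subset> F" "link v F \<subset> F"
      using v unfolding deletion_def link_def by blast+
    note smaller = this[THEN psubset_card_mono[OF F(1)]]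
    show ?thesis
      unfolding alternating_faces_deletion_link
      by (rule euler_char_deletion_link[
            OF less.hyps[OF smaller(1) finite_simplicial_complex_deletion[OF less.prems]]
              less.hyps[OF smaller(2) finite_simplicial_complex_link[OF less.prems]]])
  qed
qed

corollary alternating_faces_homeomorphic:
  assumes "finite_simplicial_complex F" "finite_simplicial_complex F'"
    and "geometric_realization F homeomorphic_space geometric_realization F'"
  shows "alternating_faces F = alternating_faces F'"
  by (rule euler_char_unique[OF euler_char_geometric_realization[OF assms(1)]
        euler_char_homotopy_equivalent[OF homeomorphic_imp_homotopy_equivalent_space[OF assms(3)]
          euler_char_geometric_realization[OF assms(2)]]])

section \<open>Geometric coefficients and chains of faces of a simplex\<close>

lemma fps_eq_geometric_iff:
  fixes \<gamma> :: "'k::field fps"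
  shows "\<gamma> = fps_const c / (1 + fps_X) \<longleftrightarrow> (\<forall>n. fps_nth \<gamma> n = (-1) ^ n * c)"
proof -
  have "fps_const c / (1 + fps_X) = fps_const c * Abs_fps (\<lambda>n. (- 1) ^ n)"
    by (subst fps_divide_unit) (simp_all add: fps_inverse_fps_X_plus1)
  then show ?thesis by (auto simp: fps_eq_iff mult.commute)
qed

lemma chi_geometric:
  assumes "finite_simplicial_complex F" "\<And>n. fps_nth \<gamma> n = (-1) ^ n * c"
  shows "chi \<gamma> F = of_int (alternating_faces F) * c"
  using assms by (simp add: chi_eq_sum_faces alternating_faces_def sum_distrib_right)

lemma alternating_faces_simplex: "alternating_faces (simplex_complex n) = 1"
proof -
  interpret complex_vertex "simplex_complex n" 0
    by unfold_locales
      (rule finite_simplicial_complex_simplex_complex, simp add: simplex_complex_def)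
  show ?thesis
    by (rule alternating_faces_cone) (auto simp: deletion_def link_def simplex_complex_def)
qed

lemma finite_simplicial_complex_sd_simplex:
  "finite_simplicial_complex (barycentric_subdivision (simplex_complex n))"
  by (intro finite_simplicial_complex_barycentric_subdivision
      finite_simplicial_complex_simplex_complex)

lemma sd_simplex_iff:
  "C \<in> barycentric_subdivision (simplex_complex n) \<longleftrightarrow>
     C \<noteq> {} \<and> (\<forall>X\<in>C. X \<subseteq> {..n} \<and> X \<noteq> {}) \<and> (\<forall>X\<in>C. \<forall>Y\<in>C. X \<subseteq> Y \<or> Y \<subseteq> X)"
  by (auto simp: barycentric_subdivision_def subset_chain_def simplex_complex_def)

lemma alternating_faces_sd_simplex:
  "alternating_faces (barycentric_subdivision (simplex_complex n)) = 1"
proof -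
  \<comment> \<open>The full face is comparable with every face and can be added to every chain; it
    is the apex of a cone.\<close>
  interpret complex_vertex "barycentric_subdivision (simplex_complex n)" "{..n}"
    by unfold_locales (rule finite_simplicial_complex_sd_simplex, auto simp: sd_simplex_iff)
  show ?thesis
  proof (rule alternating_faces_cone, rule Set.set_eqI)
    fix C
    have "insert {..n} C \<in> barycentric_subdivision (simplex_complex n)"
      if "C \<in> barycentric_subdivision (simplex_complex n)"
      using that unfolding sd_simplex_iff by auto
    then show "C \<in> deletion {..n} (barycentric_subdivision (simplex_complex n)) \<longleftrightarrow>
        C \<in> link {..n} (barycentric_subdivision (simplex_complex n))"
      by (auto simp: deletion_def link_def)
  qed
qed

text \<open>Members of a chain have distinct sizes, all between 1 and \<open>n + 1\<close>.\<close>

lemma card_sd_simplex_face_le: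
  assumes "C \<in> barycentric_subdivision (simplex_complex n)"
  shows "card C \<le> n + 1"
proof -
  have fin: "finite X" if "X \<in> C" for X
    using assms that finite_subset[of X "{..n}"] by (auto simp: sd_simplex_iff)
  have "inj_on card C"
  proof (rule inj_onI)
    fix X Y assume XY: "X \<in> C" "Y \<in> C" "card X = card Y"
    then have "X \<subseteq> Y \<or> Y \<subseteq> X" using assms by (auto simp: sd_simplex_iff)
    then show "X = Y"
      using card_subset_eq[of X Y] card_subset_eq[of Y X] fin[OF XY(1)] fin[OF XY(2)] XY(3) by auto
  qed
  moreover have "card ` C \<subseteq> {1..n + 1}"
  proof clarify
    fix X assume X: "X \<in> C"
    then have "X \<subseteq> {..n}" "X \<noteq> {}" using assms by (auto simp: sd_simplex_iff)
    then show "card X \<in> {1..n + 1}"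
      using fin[OF X] card_mono[of "{..n}" X] by (auto simp: card_gt_0_iff Suc_le_eq)
  qed
  ultimately show ?thesis
    using card_inj_on_le[of card C "{1..n + 1}"] by simp
qed

lemma two_maximal_chains:
  assumes "n > 0"
  shows "2 \<le> card {C \<in> barycentric_subdivision (simplex_complex n). card C = n + 1}"
proof -
  let ?S = "{C \<in> barycentric_subdivision (simplex_complex n). card C = n + 1}"
  \<comment> \<open>Initial segments and final segments form two maximal chains. They differ in the
    singleton of 0 as soon as \<open>n > 0\<close>.\<close>
  define A where "A = (\<lambda>i. {..i}) ` {..n}"
  define B where "B = (\<lambda>i. {i..n}) ` {..n}"
  have "inj_on (\<lambda>i. {..i}) {..n}" "inj_on (\<lambda>i. {i..n}) {..n}"
    by (auto intro!: inj_onI)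
  then have "card A = n + 1" "card B = n + 1"
    by (simp_all add: A_def B_def card_image)
  moreover have "A \<in> barycentric_subdivision (simplex_complex n)"
    unfolding sd_simplex_iff A_def by auto
  moreover have "B \<in> barycentric_subdivision (simplex_complex n)"
    unfolding sd_simplex_iff B_def by auto
  ultimately have sub: "{A, B} \<subseteq> ?S" by simp
  have "{..0} \<in> A" unfolding A_def by (rule imageI) simp
  moreover have "{..0} \<notin> B"
  proof
    assume "{..0} \<in> B"
    then obtain i where i: "{..0} = {i..n}" "i \<le> n" unfolding B_def by auto
    then have "n \<in> {..0::nat}" unfolding i(1) by simp
    then show False using assms by simp
  qed
  ultimately have "card {A, B} = 2" by (metis card_2_iff)
  moreover have "finite ?S" using complexD(1)[OF finite_simplicial_complex_sd_simplex] by simp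
  ultimately show ?thesis using card_mono[OF _ sub] by simp
qed

lemma sum_faces_top:
  fixes \<delta> :: "nat \<Rightarrow> 'k::field"
  assumes "finite F" "\<And>\<sigma>. \<sigma> \<in> F \<Longrightarrow> card \<sigma> \<le> n + 1" "\<And>k. k < n \<Longrightarrow> \<delta> k = 0"
    "\<And>\<sigma>. \<sigma> \<in> F \<Longrightarrow> \<sigma> \<noteq> {}" "\<And>\<sigma>. \<sigma> \<in> F \<Longrightarrow> finite \<sigma>"
  shows "(\<Sum>\<sigma>\<in>F. \<delta> (card \<sigma> - 1)) = of_nat (card {\<sigma> \<in> F. card \<sigma> = n + 1}) * \<delta> n"
proof -
  have "(\<Sum>\<sigma>\<in>F. \<delta> (card \<sigma> - 1)) = (\<Sum>\<sigma>\<in>{\<sigma> \<in> F. card \<sigma> = n + 1}. \<delta> n)"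
  proof (intro sum.mono_neutral_cong_right ballI)
    fix \<sigma> assume \<sigma>: "\<sigma> \<in> F - {\<sigma> \<in> F. card \<sigma> = n + 1}"
    then have "card \<sigma> > 0" "card \<sigma> \<le> n + 1" "card \<sigma> \<noteq> n + 1"
      using assms(2,4,5) by (auto simp: card_gt_0_iff)
    then show "\<delta> (card \<sigma> - 1) = 0" by (intro assms(3)) linarith
  next
    show "finite F" by (rule assms(1))
  qed auto
  then show ?thesis by simp
qed

lemma sd_invariant_imp_geometric:
  fixes \<gamma> :: "'k::field_char_0 fps"
  assumes "sd_invariant_on_simplices \<gamma>"
  shows "fps_nth \<gamma> n = (-1) ^ n * fps_nth \<gamma> 0"
proof -
  \<comment> \<open>The simplex and its subdivision both have alternating face count 1, so
    \<open>\<delta>\<close> inherits the invariance of \<gamma>, and it vanishes at 0.\<close>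
  define \<delta> where "\<delta> n = fps_nth \<gamma> n - (-1) ^ n * fps_nth \<gamma> 0" for n
  have sum: "(\<Sum>\<sigma>\<in>F. \<delta> (card \<sigma> - 1)) = chi \<gamma> F - of_int (alternating_faces F) * fps_nth \<gamma> 0"
    if "finite_simplicial_complex F" for F :: "'a set set"
    using that
    by (simp add: \<delta>_def chi_eq_sum_faces alternating_faces_def sum_subtractf sum_distrib_right)
  have "\<delta> n = 0"
  proof (induction n rule: less_induct)
    case (less n)
    show ?case
    proof (cases "n = 0")
      case True
      then show ?thesis by (simp add: \<delta>_def)
    next
      case False
      let ?D = "simplex_complex n" and ?S = "barycentric_subdivision (simplex_complex n)"
      note D = finite_simplicial_complex_simplex_complex[of n]
      note S = finite_simplicial_complex_sd_simplex[of n]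
      have D1: "{\<sigma> \<in> ?D. card \<sigma> = n + 1} = {{..n}}"
      proof (intro Set.set_eqI iffI)
        fix \<sigma> assume "\<sigma> \<in> {\<sigma> \<in> ?D. card \<sigma> = n + 1}"
        then show "\<sigma> \<in> {{..n}}"
          using card_subset_eq[of "{..n}" \<sigma>] by (auto simp: simplex_complex_def)
      qed (auto simp: simplex_complex_def)
      have "(\<Sum>\<sigma>\<in>?S. \<delta> (card \<sigma> - 1)) = (\<Sum>\<sigma>\<in>?D. \<delta> (card \<sigma> - 1))"
        using assms
        unfolding sum[OF D] sum[OF S] alternating_faces_simplex alternating_faces_sd_simplex
          sd_invariant_on_simplices_def by simp
      moreover have "(\<Sum>\<sigma>\<in>?S. \<delta> (card \<sigma> - 1)) = of_nat (card {\<sigma> \<in> ?S. card \<sigma> = n + 1}) * \<delta> n"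
        by (rule sum_faces_top[OF complexD(1)[OF S] card_sd_simplex_face_le less complexD(3,2)[OF S]])
      moreover have "(\<Sum>\<sigma>\<in>?D. \<delta> (card \<sigma> - 1)) = of_nat (card {\<sigma> \<in> ?D. card \<sigma> = n + 1}) * \<delta> n"
      proof (rule sum_faces_top)
        show "card \<sigma> \<le> n + 1" if "\<sigma> \<in> ?D" for \<sigma>
          using that card_mono[of "{..n}" \<sigma>] by (auto simp: simplex_complex_def)
      qed (rule complexD(1)[OF D] less complexD(3,2)[OF D]; assumption)+
      ultimately have "of_nat (card {\<sigma> \<in> ?S. card \<sigma> = n + 1}) * \<delta> n = of_nat 1 * \<delta> n"
        unfolding D1 by simp
      \<comment> \<open>In characteristic zero the second alternative becomes an equation of natural
        numbers, contradicting the existence of two maximal chains.\<close>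
      then have "\<delta> n = 0 \<or> of_nat (card {\<sigma> \<in> ?S. card \<sigma> = n + 1}) = (of_nat 1 :: 'k)"
        by (simp only: mult_cancel_right)
      then show ?thesis
        using two_maximal_chains[of n] False unfolding of_nat_eq_iff by linarith
    qed
  qed
  then show ?thesis by (simp add: \<delta>_def)
qed

section \<open>Subdividing an edge of a simplex\<close>

text \<open>Trades the sum over the varying support for one over a fixed finite set, which makes the
  condition linear in the coordinates.\<close>

lemma realization_points_iff:
  assumes "finite U" "\<Union>F \<subseteq> U"
  shows "x \<in> realization_points F \<longleftrightarrow> (\<forall>v. 0 \<le> x v) \<and> {v. x v \<noteq> 0} \<in> F \<and> sum x U = 1"
proof -
  have "(\<Sum>v | x v \<noteq> 0. x v) = sum x U" if "{v. x v \<noteq> 0} \<in> F"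
  proof (intro sum.mono_neutral_left assms(1) ballI)
    show "{v. x v \<noteq> 0} \<subseteq> U" using that assms(2) by blast
  qed simp
  then show ?thesis by (auto simp: realization_points_def)
qed

lemma continuous_map_realization:
  assumes "\<And>w. continuous_map (geometric_realization F) euclideanreal (\<lambda>x. f x w)"
    "\<And>x. x \<in> realization_points F \<Longrightarrow> f x \<in> realization_points F'"
  shows "continuous_map (geometric_realization F) (geometric_realization F') f"
proof -
  have "continuous_map (geometric_realization F) (powertop_real UNIV) f"
    unfolding continuous_map_componentwise_UNIV using assms(1) by blast
  then show ?thesis
    using assms(2) unfolding geometric_realization_eq[of F'] continuous_map_in_subtopology by auto
qed

lemma continuous_map_realization_coordinate:
  "continuous_map (geometric_realization F) euclideanreal (\<lambda>x. x w)"
  unfolding geometric_realization_eq by (rule continuous_map_coordinate)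

text \<open>Relabelling of vertices along an injection: the explicit complexes live on the natural
  numbers and have to be moved into arbitrary infinite types.\<close>

lemma finite_simplicial_complex_image:
  assumes F: "finite_simplicial_complex F"
  shows "finite_simplicial_complex ((`) g ` F)"
proof (rule finite_simplicial_complexI)
  show "finite ((`) g ` F)" using complexD(1)[OF F] by simp
next
  fix \<sigma> assume "\<sigma> \<in> (`) g ` F"
  then obtain \<rho> where \<rho>: "\<rho> \<in> F" "\<sigma> = g ` \<rho>" by auto
  show "finite \<sigma>" "\<sigma> \<noteq> {}" using complexD(2,3)[OF F \<rho>(1)] \<rho>(2) by simp_all
  fix \<tau> assume "\<tau> \<subseteq> \<sigma>" "\<tau> \<noteq> {}"
  then obtain \<pi> where "\<pi> \<subseteq> \<rho>" "\<tau> = g ` \<pi>" "\<pi> \<noteq> {}" using \<rho>(2) by (metis image_empty subset_imageE)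
  then show "\<tau> \<in> (`) g ` F" using complexD(4)[OF F \<rho>(1)] by blast
qed

lemma chi_image:
  assumes "finite_simplicial_complex F" "inj g"
  shows "chi \<gamma> ((`) g ` F) = chi \<gamma> F"
proof -
  have "inj_on ((`) g) F" using assms(2) by (simp add: inj_image_eq_iff inj_on_def)
  moreover have "card (g ` \<sigma>) = card \<sigma>" for \<sigma>
    using assms(2) by (simp add: card_image inj_on_subset)
  ultimately show ?thesis
    using assms(1) by (simp add: chi_eq_sum_faces finite_simplicial_complex_image sum.reindex)
qed

lemma geometric_realization_image:
  assumes F: "finite_simplicial_complex F" and g: "inj g"
  shows "geometric_realization F homeomorphic_space geometric_realization ((`) g ` F)"
proof -
  define U where "U = \<Union>F"
  have U: "finite U" "\<Union>F \<subseteq> U" "finite (g ` U)" "\<Union>((`) g ` F) \<subseteq> g ` U"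
    using complexD(1,2)[OF F] by (auto simp: U_def)
  \<comment> \<open>Off the range of \<open>g\<close> the coordinate is set to 0, which is its value
    at all points of the relabelled realization; there \<open>\<phi>\<close> inverts
    \<open>\<psi>\<close>.\<close>
  define \<phi> where "\<phi> x b = (if b \<in> range g then x (inv_into UNIV g b) else 0)" for x :: "'a \<Rightarrow> real" and b
  define \<psi> where "\<psi> y a = y (g a)" for y :: "'b \<Rightarrow> real" and a
  have \<phi>g: "\<phi> x (g a) = x a" for x a using g by (simp add: \<phi>_def)
  have supp: "{b. \<phi> x b \<noteq> 0} = g ` {a. x a \<noteq> 0}" for x
    using g by (auto simp: \<phi>_def inj_eq)
  have "\<phi> x \<in> realization_points ((`) g ` F)" if x: "x \<in> realization_points F" for x
  proof -
    have "sum (\<phi> x) (g ` U) = sum x U"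
      using g by (simp add: sum.reindex inj_on_subset \<phi>g)
    moreover have "0 \<le> \<phi> x b" for b
      using x by (auto simp: \<phi>_def realization_points_def)
    ultimately show ?thesis
      using x unfolding realization_points_iff[OF U(1,2)] realization_points_iff[OF U(3,4)] supp
      by auto
  qed
  then have c1: "continuous_map (geometric_realization F) (geometric_realization ((`) g ` F)) \<phi>"
  proof (intro continuous_map_realization)
    show "continuous_map (geometric_realization F) euclideanreal (\<lambda>x. \<phi> x b)" for b
      by (cases "b \<in> range g") (simp_all add: \<phi>_def continuous_map_realization_coordinate)
  qed
  have face: "y b = 0 \<or> b \<in> range g" if "y \<in> realization_points ((`) g ` F)" for y b
    using that by (auto simp: realization_points_def)
  have "\<psi> y \<in> realization_points F" if y: "y \<in> realization_points ((`) g ` F)" for y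
  proof -
    have "{b. y b \<noteq> 0} \<in> (`) g ` F" using y by (simp add: realization_points_def)
    then obtain \<sigma> where \<sigma>: "\<sigma> \<in> F" "{b. y b \<noteq> 0} = g ` \<sigma>" by auto
    have "a \<in> {a. \<psi> y a \<noteq> 0} \<longleftrightarrow> g a \<in> g ` \<sigma>" for a
      unfolding \<sigma>(2)[symmetric] by (simp add: \<psi>_def)
    then have "{a. \<psi> y a \<noteq> 0} = \<sigma>" using g by (simp add: inj_image_mem_iff set_eq_iff)
    moreover have "sum (\<psi> y) U = sum y (g ` U)"
      using g by (simp add: sum.reindex inj_on_subset \<psi>_def o_def)
    moreover have "0 \<le> \<psi> y a" for a
      using y by (simp add: \<psi>_def realization_points_def)
    ultimately show ?thesis
      using y \<sigma>(1) unfolding realization_points_iff[OF U(1,2)] realization_points_iff[OF U(3,4)]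
      by auto
  qed
  then have c2: "continuous_map (geometric_realization ((`) g ` F)) (geometric_realization F) \<psi>"
    by (intro continuous_map_realization)
      (simp_all add: \<psi>_def continuous_map_realization_coordinate)
  have "\<psi> (\<phi> x) = x" for x by (simp add: \<psi>_def \<phi>g fun_eq_iff)
  moreover have "\<phi> (\<psi> y) = y" if "y \<in> realization_points ((`) g ` F)" for y
  proof
    show "\<phi> (\<psi> y) b = y b" for b
      using face[OF that, of b] g by (cases "b \<in> range g") (auto simp: \<phi>_def \<psi>_def)
  qed
  ultimately have "homeomorphic_maps (geometric_realization F) (geometric_realization ((`) g ` F)) \<phi> \<psi>"
    using c1 c2 by (simp add: homeomorphic_maps_def)
  then show ?thesis by (auto simp: homeomorphic_space_def)
qed

text \<open>The simplex on \<open>{..n + 1}\<close> with its edge \<open>{0, 1}\<close> subdivided by the new vertex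
  \<open>n + 2\<close>.\<close>

definition edge_subdivision :: "nat \<Rightarrow> nat set set" where
  "edge_subdivision n = {\<sigma>. \<sigma> \<subseteq> {..n + 2} \<and> \<sigma> \<noteq> {} \<and> \<not> {0, 1} \<subseteq> \<sigma>}"

lemma finite_simplicial_complex_edge_subdivision:
  "finite_simplicial_complex (edge_subdivision n)"
proof (rule finite_simplicial_complexI)
  have "edge_subdivision n \<subseteq> Pow {..n + 2}" by (auto simp: edge_subdivision_def)
  then show "finite (edge_subdivision n)" by (rule finite_subset) simp
next
  fix \<sigma> assume "\<sigma> \<in> edge_subdivision n"
  then have "\<sigma> \<subseteq> {..n + 2}" by (simp add: edge_subdivision_def)
  then show "finite \<sigma>" by (rule finite_subset) simp
qed (auto simp: edge_subdivision_def)

section \<open>Coordinates and homeomorphism for the subdivided edge\<close>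

lemma vertices_split: "{..n + 2} = insert 0 (insert 1 (insert (n + 2) {2..n + 1}))" for n :: nat
  by auto

lemma realization_points_simplex_iff:
  "x \<in> realization_points (simplex_complex (n + 1)) \<longleftrightarrow>
     (\<forall>v. 0 \<le> x v) \<and> (\<forall>v\<ge>n + 2. x v = 0) \<and> x 0 + x 1 + sum x {2..n + 1} = 1"
proof -
  have split: "{..n + 1} = insert 0 (insert 1 {2..n + 1})" by auto
  have sum: "sum x {..n + 1} = x 0 + x 1 + sum x {2..n + 1}" unfolding split by simp
  have "{v. x v \<noteq> 0} \<in> simplex_complex (n + 1) \<longleftrightarrow> (\<forall>v\<ge>n + 2. x v = 0)"
    if "sum x {..n + 1} = 1"
  proof -
    have ne: "{v. x v \<noteq> 0} \<noteq> {}" using that by (metis (mono_tags) empty_Collect_eq sum.neutral zero_neq_one)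
    have "v \<le> n + 1 \<longleftrightarrow> \<not> n + 2 \<le> v" for v by auto
    then have "{v. x v \<noteq> 0} \<subseteq> {..n + 1} \<longleftrightarrow> (\<forall>v\<ge>n + 2. x v = 0)"
      unfolding subset_iff mem_Collect_eq atMost_iff by blast
    with ne show ?thesis by (simp add: simplex_complex_def)
  qed
  moreover have "\<Union>(simplex_complex (n + 1)) \<subseteq> {..n + 1}" by (auto simp: simplex_complex_def)
  ultimately show ?thesis
    unfolding sum[symmetric] by (auto simp: realization_points_iff[of "{..n + 1}"])
qed

lemma realization_points_edge_subdivision_iff:
  "x \<in> realization_points (edge_subdivision n) \<longleftrightarrow>
     (\<forall>v. 0 \<le> x v) \<and> (\<forall>v\<ge>n + 3. x v = 0) \<and> (x 0 = 0 \<or> x 1 = 0) \<and>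
     x 0 + x 1 + x (n + 2) + sum x {2..n + 1} = 1"
proof -
  have sum: "sum x {..n + 2} = x 0 + x 1 + x (n + 2) + sum x {2..n + 1}"
    unfolding vertices_split by simp
  have "{v. x v \<noteq> 0} \<in> edge_subdivision n \<longleftrightarrow> (\<forall>v\<ge>n + 3. x v = 0) \<and> (x 0 = 0 \<or> x 1 = 0)"
    if "sum x {..n + 2} = 1"
  proof -
    have ne: "{v. x v \<noteq> 0} \<noteq> {}" using that by (metis (mono_tags) empty_Collect_eq sum.neutral zero_neq_one)
    have "v \<le> n + 2 \<longleftrightarrow> \<not> n + 3 \<le> v" for v by auto
    then have "{v. x v \<noteq> 0} \<subseteq> {..n + 2} \<longleftrightarrow> (\<forall>v\<ge>n + 3. x v = 0)"
      unfolding subset_iff mem_Collect_eq atMost_iff by blast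
    with ne show ?thesis by (auto simp: edge_subdivision_def)
  qed
  moreover have "\<Union>(edge_subdivision n) \<subseteq> {..n + 2}" by (auto simp: edge_subdivision_def)
  ultimately show ?thesis
    unfolding sum[symmetric] by (auto simp: realization_points_iff[of "{..n + 2}"])
qed

lemma edge_subdivision_homeomorphic:
  "geometric_realization (simplex_complex (n + 1)) homeomorphic_space
     geometric_realization (edge_subdivision n)"
proof -
  \<comment> \<open>The new vertex is the midpoint of the edge. The mass common to
    \<open>x 0\<close> and \<open>x 1\<close> moves there, counted twice, and leaves one of the two
    at 0; \<open>\<psi>\<close> returns half of it to each end.\<close>
  define \<phi> :: "(nat \<Rightarrow> real) \<Rightarrow> nat \<Rightarrow> real" where "\<phi> x w =
    (if w = n + 2 then 2 * min (x 0) (x 1)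
     else if w = 0 \<or> w = 1 then x w - min (x 0) (x 1) else x w)" for x w
  define \<psi> :: "(nat \<Rightarrow> real) \<Rightarrow> nat \<Rightarrow> real" where "\<psi> y w =
    (if w = n + 2 then 0 else if w = 0 \<or> w = 1 then y w + y (n + 2) / 2 else y w)" for y w
  have sum: "sum (\<phi> x) {2..n + 1} = sum x {2..n + 1}" "sum (\<psi> x) {2..n + 1} = sum x {2..n + 1}" for x
    by (auto intro!: sum.cong simp: \<phi>_def \<psi>_def)
  have "\<phi> x \<in> realization_points (edge_subdivision n)"
    if "x \<in> realization_points (simplex_complex (n + 1))" for x
    using that unfolding realization_points_simplex_iff realization_points_edge_subdivision_iff sum
    by (auto simp: \<phi>_def min_def)
  then have c1: "continuous_map (geometric_realization (simplex_complex (n + 1)))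
      (geometric_realization (edge_subdivision n)) \<phi>"
  proof (intro continuous_map_realization)
    fix w
    note [continuous_intros] = continuous_map_realization_coordinate
    consider "w = n + 2" | "w = 0 \<or> w = 1" "w \<noteq> n + 2" | "w \<noteq> n + 2" "w \<noteq> 0" "w \<noteq> 1" by blast
    then show "continuous_map (geometric_realization (simplex_complex (n + 1))) euclideanreal
        (\<lambda>x. \<phi> x w)"
      unfolding \<phi>_def
      by cases (simp_all only: if_True if_False simp_thms, (intro continuous_intros; simp)+)
  qed
  have "\<psi> x \<in> realization_points (simplex_complex (n + 1))"
    if "x \<in> realization_points (edge_subdivision n)" for x
    using that unfolding realization_points_simplex_iff realization_points_edge_subdivision_iff sum
    by (auto simp: \<psi>_def)
  then have c2: "continuous_map (geometric_realization (edge_subdivision n))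
      (geometric_realization (simplex_complex (n + 1))) \<psi>"
  proof (intro continuous_map_realization)
    fix w
    note [continuous_intros] = continuous_map_realization_coordinate
    consider "w = n + 2" | "w = 0 \<or> w = 1" "w \<noteq> n + 2" | "w \<noteq> n + 2" "w \<noteq> 0" "w \<noteq> 1" by blast
    then show "continuous_map (geometric_realization (edge_subdivision n)) euclideanreal
        (\<lambda>x. \<psi> x w)"
      unfolding \<psi>_def
      by cases (simp_all only: if_True if_False simp_thms, (intro continuous_intros; simp)+)
  qed
  have "\<psi> (\<phi> x) = x" if "x \<in> realization_points (simplex_complex (n + 1))" for x
    using that unfolding realization_points_simplex_iff by (auto simp: \<psi>_def \<phi>_def fun_eq_iff)
  moreover have "\<phi> (\<psi> y) = y" if y: "y \<in> realization_points (edge_subdivision n)" for y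
  proof
    fix w
    have "0 \<le> y 0" "0 \<le> y 1" "y 0 = 0 \<or> y 1 = 0"
      using y unfolding realization_points_edge_subdivision_iff by blast+
    \<comment> \<open>One of \<open>y 0\<close> and \<open>y 1\<close> is zero, so after adding the
      same amount to both, the minimum is that amount.\<close>
    then have "min (\<psi> y 0) (\<psi> y 1) = y (n + 2) / 2" by (auto simp: \<psi>_def min_def)
    then show "\<phi> (\<psi> y) w = y w" by (auto simp: \<phi>_def) (auto simp: \<psi>_def)
  qed
  ultimately have "homeomorphic_maps (geometric_realization (simplex_complex (n + 1)))
      (geometric_realization (edge_subdivision n)) \<phi> \<psi>"
    using c1 c2 by (simp add: homeomorphic_maps_def)
  then show ?thesis by (auto simp: homeomorphic_space_def)
qed

section \<open>Face counts and the recursion for the coefficients\<close>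

lemma sum_Pow_insert:
  fixes h :: "'a set \<Rightarrow> 'c::comm_monoid_add"
  assumes "finite A" "a \<notin> A"
  shows "sum h (Pow (insert a A)) = (\<Sum>\<sigma>\<in>Pow A. h \<sigma> + h (insert a \<sigma>))"
proof -
  have "inj_on (insert a) (Pow A)"
    using assms(2) by (intro inj_onI) (auto simp: insert_ident subset_iff)
  moreover have "Pow A \<inter> insert a ` Pow A = {}" using assms(2) by auto
  ultimately show ?thesis
    unfolding Pow_insert using assms(1)
    by (simp add: sum.union_disjoint sum.reindex sum.distrib)
qed

text \<open>Sort the faces by their trace \<open>\<sigma>\<close> on \<open>{2..n + 1}\<close>. In
  the simplex \<open>\<sigma>\<close> is extended by nothing, 0, 1 or both; in the subdivision, with
  m the new vertex, by nothing, 0, 1, m, 0m or 1m. This is one more extension by a single vertex and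
  one more by two.\<close>

lemma chi_edge_subdivision:
  fixes \<gamma> :: "'k::field fps"
  shows "chi \<gamma> (edge_subdivision n) = chi \<gamma> (simplex_complex (n + 1)) +
    (\<Sum>\<sigma>\<in>Pow {2..n + 1}. fps_nth \<gamma> (card \<sigma>) + fps_nth \<gamma> (card \<sigma> + 1))"
proof -
  let ?B = "{2..n + 1}"
  \<comment> \<open>The value 0 at the empty set allows sums over full power sets, with no exception
    for an empty trace.\<close>
  define h where "h \<sigma> = (if \<sigma> = {} then 0 else fps_nth \<gamma> (card \<sigma> - 1))" for \<sigma> :: "nat set"
  have h1: "h (insert a \<sigma>) = fps_nth \<gamma> (card \<sigma>)" if "finite \<sigma>" "a \<notin> \<sigma>" for a \<sigma>
    using that by (simp add: h_def)
  have h2: "h (insert a (insert b \<sigma>)) = fps_nth \<gamma> (card \<sigma> + 1)"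
    if "finite \<sigma>" "a \<notin> \<sigma>" "b \<notin> \<sigma>" "a \<noteq> b" for a b \<sigma>
    using that by (simp add: h_def)
  have chi: "chi \<gamma> F = sum h (insert {} F)" if "finite_simplicial_complex F" for F
  proof -
    have "sum h (insert {} F) = h {} + sum h F"
      using complexD(1,3)[OF that] by (intro sum.insert) blast+
    moreover have "sum h F = (\<Sum>\<sigma>\<in>F. fps_nth \<gamma> (card \<sigma> - 1))"
      using complexD(3)[OF that] by (intro sum.cong) (auto simp: h_def)
    ultimately show ?thesis by (simp add: chi_eq_sum_faces[OF that] h_def)
  qed
  have sub: "finite \<sigma>" "0 \<notin> \<sigma>" "1 \<notin> \<sigma>" "n + 2 \<notin> \<sigma>" if "\<sigma> \<in> Pow ?B" for \<sigma>
    using that finite_subset[of \<sigma> ?B] by auto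
  have "insert {} (simplex_complex (n + 1)) = Pow (insert 0 (insert 1 ?B))"
    by (auto simp: simplex_complex_def)
  then have "chi \<gamma> (simplex_complex (n + 1)) = sum h (Pow (insert 0 (insert 1 ?B)))"
    using chi[OF finite_simplicial_complex_simplex_complex] by metis
  also have "\<dots> = (\<Sum>\<sigma>\<in>Pow ?B. h \<sigma> + h (insert 0 \<sigma>) + (h (insert 1 \<sigma>) + h (insert 0 (insert 1 \<sigma>))))"
    by (simp add: sum_Pow_insert)
  also have "\<dots> = (\<Sum>\<sigma>\<in>Pow ?B. h \<sigma> + 2 * fps_nth \<gamma> (card \<sigma>) + fps_nth \<gamma> (card \<sigma> + 1))"
  proof (intro sum.cong refl)
    fix \<sigma> assume "\<sigma> \<in> Pow ?B"
    note \<sigma> = sub[OF this]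
    show "h \<sigma> + h (insert 0 \<sigma>) + (h (insert 1 \<sigma>) + h (insert 0 (insert 1 \<sigma>))) =
        h \<sigma> + 2 * fps_nth \<gamma> (card \<sigma>) + fps_nth \<gamma> (card \<sigma> + 1)"
      unfolding h1[OF \<sigma>(1,2)] h1[OF \<sigma>(1,3)] h2[OF \<sigma>(1,2,3) zero_neq_one] by simp
  qed
  finally have simplex: "chi \<gamma> (simplex_complex (n + 1)) =
    (\<Sum>\<sigma>\<in>Pow ?B. h \<sigma> + 2 * fps_nth \<gamma> (card \<sigma>) + fps_nth \<gamma> (card \<sigma> + 1))" .
  let ?C = "insert (n + 2) ?B"
  \<comment> \<open>Split by whether 1 occurs; a face containing 1 must avoid 0.\<close>
  have faces: "insert {} (edge_subdivision n) =
      Pow (insert 0 ?C) \<union> insert 1 ` Pow ?C"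
  proof (intro Set.set_eqI iffI)
    fix \<sigma> assume "\<sigma> \<in> insert {} (edge_subdivision n)"
    then have \<sigma>: "\<sigma> \<subseteq> insert 0 (insert 1 ?C)" "\<not> {0, 1} \<subseteq> \<sigma>"
      unfolding edge_subdivision_def vertices_split by auto
    show "\<sigma> \<in> Pow (insert 0 ?C) \<union> insert 1 ` Pow ?C"
    proof (cases "1 \<in> \<sigma>")
      case True
      then have "\<sigma> = insert 1 (\<sigma> - {1})" "\<sigma> - {1} \<subseteq> ?C" using \<sigma> by auto
      then show ?thesis by blast
    next
      case False
      then show ?thesis using \<sigma> by blast
    qed
  qed (auto simp: edge_subdivision_def subset_iff)
  have "chi \<gamma> (edge_subdivision n) = sum h (Pow (insert 0 ?C) \<union> insert 1 ` Pow ?C)"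
    using chi[OF finite_simplicial_complex_edge_subdivision] faces by metis
  also have "\<dots> = sum h (Pow (insert 0 ?C)) + sum h (insert 1 ` Pow ?C)"
    by (rule sum.union_disjoint) auto
  also have "sum h (insert 1 ` Pow ?C) = (\<Sum>\<sigma>\<in>Pow ?C. h (insert 1 \<sigma>))"
  proof (subst sum.reindex)
    show "inj_on (insert 1) (Pow ?C)"
    proof (rule inj_onI)
      fix \<sigma> \<tau> assume "\<sigma> \<in> Pow ?C" "\<tau> \<in> Pow ?C" "insert 1 \<sigma> = insert 1 \<tau>"
      moreover from this have "1 \<notin> \<sigma>" "1 \<notin> \<tau>" by auto
      ultimately show "\<sigma> = \<tau>" by (simp add: insert_ident)
    qed
  qed simp
  finally have "chi \<gamma> (edge_subdivision n) =
    (\<Sum>\<sigma>\<in>Pow ?B. h \<sigma> + h (insert 0 \<sigma>) + (h (insert (n + 2) \<sigma>) + h (insert 0 (insert (n + 2) \<sigma>))) +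
       (h (insert 1 \<sigma>) + h (insert 1 (insert (n + 2) \<sigma>))))"
    by (simp add: sum_Pow_insert sum.distrib)
  also have "\<dots> = (\<Sum>\<sigma>\<in>Pow ?B. (h \<sigma> + 2 * fps_nth \<gamma> (card \<sigma>) + fps_nth \<gamma> (card \<sigma> + 1)) +
      (fps_nth \<gamma> (card \<sigma>) + fps_nth \<gamma> (card \<sigma> + 1)))"
  proof (intro sum.cong refl)
    fix \<sigma> assume "\<sigma> \<in> Pow ?B"
    note \<sigma> = sub[OF this]
    have "0 \<noteq> n + 2" "1 \<noteq> n + 2" by simp_all
    note h2 = h2[OF \<sigma>(1,2,4) this(1)] h2[OF \<sigma>(1,3,4) this(2)]
    show "h \<sigma> + h (insert 0 \<sigma>) + (h (insert (n + 2) \<sigma>) + h (insert 0 (insert (n + 2) \<sigma>))) +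
        (h (insert 1 \<sigma>) + h (insert 1 (insert (n + 2) \<sigma>))) =
      (h \<sigma> + 2 * fps_nth \<gamma> (card \<sigma>) + fps_nth \<gamma> (card \<sigma> + 1)) +
      (fps_nth \<gamma> (card \<sigma>) + fps_nth \<gamma> (card \<sigma> + 1))"
      unfolding h1[OF \<sigma>(1,2)] h1[OF \<sigma>(1,3)] h1[OF \<sigma>(1,4)] h2 by simp
  qed
  finally show ?thesis unfolding simplex by (simp only: sum.distrib)
qed

lemma topological_invariant_imp_geometric:
  fixes \<gamma> :: "'k::field fps"
  assumes "topological_invariant TYPE('a::infinite) TYPE('b::infinite) \<gamma>"
  shows "fps_nth \<gamma> n = (-1) ^ n * fps_nth \<gamma> 0"
proof -
  have "\<exists>f :: nat \<Rightarrow> 'a. inj f \<and> range f \<subseteq> UNIV"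
    by (rule infinite_countable_subset[OF infinite_UNIV])
  then obtain f :: "nat \<Rightarrow> 'a" where f: "inj f" by (elim exE conjE)
  have "\<exists>g :: nat \<Rightarrow> 'b. inj g \<and> range g \<subseteq> UNIV"
    by (rule infinite_countable_subset[OF infinite_UNIV])
  then obtain g :: "nat \<Rightarrow> 'b" where g: "inj g" by (elim exE conjE)
  have chi: "chi \<gamma> (edge_subdivision n) = chi \<gamma> (simplex_complex (n + 1))" for n
  proof -
    note D = finite_simplicial_complex_simplex_complex[of "n + 1"]
    note E = finite_simplicial_complex_edge_subdivision[of n]
    have "geometric_realization ((`) f ` simplex_complex (n + 1)) homeomorphic_space
        geometric_realization ((`) g ` edge_subdivision n)"
      by (rule homeomorphic_space_trans[OF
            homeomorphic_space_sym[THEN iffD1, OF geometric_realization_image[OF D f]]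
            homeomorphic_space_trans[OF edge_subdivision_homeomorphic
              geometric_realization_image[OF E g]]])
    then have "chi \<gamma> ((`) f ` simplex_complex (n + 1)) = chi \<gamma> ((`) g ` edge_subdivision n)"
      using assms finite_simplicial_complex_image[OF D, of f] finite_simplicial_complex_image[OF E, of g]
      unfolding topological_invariant_def by blast
    then show ?thesis unfolding chi_image[OF D f] chi_image[OF E g] by simp
  qed
  have step: "fps_nth \<gamma> n + fps_nth \<gamma> (n + 1) = 0" for n
  proof (induction n rule: less_induct)
    case (less n)
    let ?B = "{2..n + 1}"
    have "0 = (\<Sum>\<sigma>\<in>Pow ?B. fps_nth \<gamma> (card \<sigma>) + fps_nth \<gamma> (card \<sigma> + 1))"
      using chi[of n] chi_edge_subdivision[of \<gamma> n] by simp
    \<comment> \<open>Proper subsets are smaller than \<open>n\<close> and contribute 0 by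
      induction; the full set has size exactly \<open>n\<close> and occurs once.\<close>
    also have "\<dots> = (\<Sum>\<sigma>\<in>{?B}. fps_nth \<gamma> (card \<sigma>) + fps_nth \<gamma> (card \<sigma> + 1))"
    proof (intro sum.mono_neutral_right ballI)
      fix \<sigma> assume "\<sigma> \<in> Pow ?B - {?B}"
      then have "card \<sigma> < card ?B" by (intro psubset_card_mono) auto
      then show "fps_nth \<gamma> (card \<sigma>) + fps_nth \<gamma> (card \<sigma> + 1) = 0" by (intro less.IH) simp
    qed auto
    finally show ?case by simp
  qed
  show ?thesis
  proof (induction n)
    case (Suc n)
    have "fps_nth \<gamma> (Suc n) = - fps_nth \<gamma> n" using step[of n] by (simp add: eq_neg_iff_add_eq_0 add.commute)
    with Suc show ?case by simp
  qed simp
qed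

theorem theorem7:
  fixes \<gamma> :: "'k::field_char_0 fps"
  shows "(sd_invariant_on_simplices \<gamma> \<longleftrightarrow> (\<exists>c. \<gamma> = fps_const c / (1 + fps_X))) \<and>
    (\<forall>c. \<gamma> = fps_const c / (1 + fps_X) \<longleftrightarrow> (\<forall>n. fps_nth \<gamma> n = (-1) ^ n * c)) \<and>
    (topological_invariant TYPE('a::infinite) TYPE('b::infinite) \<gamma> \<longleftrightarrow>
      (\<exists>c. \<gamma> = fps_const c / (1 + fps_X)))"
proof (intro conjI allI)
  show "\<gamma> = fps_const c / (1 + fps_X) \<longleftrightarrow> (\<forall>n. fps_nth \<gamma> n = (-1) ^ n * c)" for c
    by (rule fps_eq_geometric_iff)
  show "sd_invariant_on_simplices \<gamma> \<longleftrightarrow> (\<exists>c. \<gamma> = fps_const c / (1 + fps_X))"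
  proof
    assume "sd_invariant_on_simplices \<gamma>"
    then show "\<exists>c. \<gamma> = fps_const c / (1 + fps_X)"
      unfolding fps_eq_geometric_iff using sd_invariant_imp_geometric by blast
  next
    assume "\<exists>c. \<gamma> = fps_const c / (1 + fps_X)"
    then obtain c where c: "\<And>n. fps_nth \<gamma> n = (-1) ^ n * c"
      unfolding fps_eq_geometric_iff by blast
    show "sd_invariant_on_simplices \<gamma>"
      unfolding sd_invariant_on_simplices_def
        chi_geometric[OF finite_simplicial_complex_sd_simplex c]
        chi_geometric[OF finite_simplicial_complex_simplex_complex c]
      by (simp add: alternating_faces_simplex alternating_faces_sd_simplex)
  qed
  show "topological_invariant TYPE('a) TYPE('b) \<gamma> \<longleftrightarrow> (\<exists>c. \<gamma> = fps_const c / (1 + fps_X))"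
  proof
    assume "topological_invariant TYPE('a) TYPE('b) \<gamma>"
    from topological_invariant_imp_geometric[OF this]
    show "\<exists>c. \<gamma> = fps_const c / (1 + fps_X)"
      unfolding fps_eq_geometric_iff by blast
  next
    assume "\<exists>c. \<gamma> = fps_const c / (1 + fps_X)"
    then obtain c where c: "\<And>n. fps_nth \<gamma> n = (-1) ^ n * c"
      unfolding fps_eq_geometric_iff by blast
    show "topological_invariant TYPE('a) TYPE('b) \<gamma>"
      unfolding topological_invariant_def
    proof (intro allI impI)
      fix F :: "'a set set" and F' :: "'b set set"
      assume F: "finite_simplicial_complex F" "finite_simplicial_complex F'"
        "geometric_realization F homeomorphic_space geometric_realization F'"
      show "chi \<gamma> F = chi \<gamma> F'"
        unfolding chi_geometric[OF F(1) c] chi_geometric[OF F(2) c]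
          alternating_faces_homeomorphic[OF F] ..
    qed
  qed
qed

end
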